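(* Let $I\in J(\mathcal{P})_\lambda$ be an ideal with $\max I=\{(s_{i_j},\lambda_{i_j})\mid j=1,\dots,t\}$, $t\ge 1$, and let $R_\lambda=R_{\lambda'}\oplus R_{\lambda''}$ be the associated decomposition. Consider any orbit $$\mathcal{O}_{m',J,K}=\{(l',l'')\in R_{\lambda'}\oplus R_{\lambda''}\mid l'\in m'+R_{\lambda'}^{J\cup K},\ l''\in R_{\lambda''}^{K^*}+R_{\lambda''}^{J}\}\subset R_\lambda^{I^*}$$ of the stabilizer $G_\lambda^I$ of $e(I)$, where $J=I(\bar m')$. Let $x\in R_{\lambda''}$ be the characteristic element of the orbit of $R_{\lambda''}$ corresponding to the ideal $[J\cup K]_{\lambda''}$. Then there exist units $y_{i_1},y_{i_2},\dots,y_{i_t}\in R^*$ such that $$f:=\big((\pi^{s_{i_1}}y_{i_1},\pi^{s_{i_2}}y_{i_2},\dots,\pi^{s_{i_t}}y_{i_t}),\,x\big)\in\mathcal{O}_{m',J,K}\subset R_\lambda^{I^*},$$ and the transitive subset $\mathcal{O}$ of $R_\lambda^{I^*}\times R_\lambda^{I^*}$ corresponding to $\mathcal{O}_{m',J,K}$ is $$\mathcal{O}=\{(g\,e(I),\,g f)\mid g\in G_\lambda\}.$$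
   Context: Let $R$ be a discrete valuation ring with uniformizer $\pi$, finite residue field $\mathbb{F}_q$ and unit group $R^*$; valuations satisfy $val(0)=\infty$, and $\pi^\infty:=0$. For $\lambda=(\lambda_1^{\rho_1}>\dots>\lambda_k^{\rho_k})$ (positive integers $\lambda_1>\dots>\lambda_k$, multiplicities $\rho_i\ge1$) put $R_\lambda=\bigoplus_{i=1}^k(R/\pi^{\lambda_i}R)^{\rho_i}$ and $G_\lambda=\mathrm{Aut}_R(R_\lambda)$, acting diagonally on $R_\lambda\times R_\lambda$. The fundamental poset is $\mathcal{P}=\{(v,l)\mid l\in\mathbb{N},\,0\le v<l\}$ with $(v,l)\le(v',l')$ iff $v\ge v'$ and $l-v\le l'-v'$. Order ideals are down-closed subsets; $\max(I)$ is the set of maximal elements of $I$. For an element $e$ of a finite $R$-module $M$, fix an isomorphism $M\cong\bigoplus_i(R/\pi^{\mu_i}R)^{\sigma_i}$ ($\mu_i$ distinct); $I(e)$ is the order ideal generated by the pairs $(v_i,\mu_i)$, where $v_i$ is the minimum of the valuations of the coordinates of $e$ in the $i$-th block, over the blocks where $e$ is non-zero ($I(e)$ does not depend on the isomorphism; $I(0)=\emptyset$). For an order ideal $I$ put $M^I=\{e\in M\mid I(e)\subset I\}$ and $M^{I^*}=\{e\in M\mid I(e)=I\}$. $\mathcal{P}_\lambda=\{(v,l)\in\mathcal{P}\mid l=\lambda_i\text{ for some }i\}$ and $J(\mathcal{P})_\lambda$ is the set of order ideals $I$ with $\max(I)\subset\mathcal{P}_\lambda$; the sets $R_\lambda^{I^*}$,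 $I\in J(\mathcal{P})_\lambda$, are exactly the $G_\lambda$-orbits of $R_\lambda$. Given $I$ with $\max I=\{(s_{i_j},\lambda_{i_j})\}_{j=1}^t$, let $S=\{i_1<\dots<i_t\}$. The canonical form $e(I)\in R_\lambda^{I^*}$ has first coordinate $\pi^{s_i}$ in the block $(R/\pi^{\lambda_i}R)^{\rho_i}$ for each $i\in S$, and all other coordinates $0$; $G_\lambda^I$ is its stabilizer in $G_\lambda$. $R_{\lambda'}$ is the direct sum of the first cyclic summands of the blocks $i\in S$ (so $R_{\lambda'}\cong\bigoplus_{i\in S}R/\pi^{\lambda_i}R$) and $R_{\lambda''}$ is the direct sum of all remaining cyclic summands; elements are written $m=(m',m'')$ accordingly (up to permuting coordinates), and $e(I)'\in R_{\lambda'}$ is the projection of $e(I)$. For $m=(m',m'')\in R_\lambda^{I^*}$, $\bar m'$ is the image of $m'$ in $R_{\lambda'}/R\,e(I)'$; put $J=I(\bar m')$ and $K=I(m'')$. The set $\mathcal{O}_{m',J,K}$ displayed in the claim is then the $G_\lambda^I$-orbit of $m$ (known), and every $G_\lambda^I$-orbit in $R_\lambda^{I^*}$ is of this form. $[J\cup K]_{\lambda''}$ is the order ideal generated by the elements $(v,l)\in J\cup K$ such that $l$ is the exponent of a cyclic summand of $R_{\lambda''}$; for such $l$ its boundary valuation is $\min\{v\mid(v,l)\in J\cup K\}$. The characteristic element $x\in R_{\lambda''}$ of the corresponding orbit has the following blocks, with $r_i=\min\{v\mid(v,\lambda_i)\in J\cup K\}$ (and $r_i=\infty$ if there is no such $v$):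 for $i\notin S$ its block is $\pi^{r_i}(1,0,\dots,0)\in(R/\pi^{\lambda_i}R)^{\rho_i}$; for $i\in S$ with $\rho_i>1$ its block is $\pi^{r_i}(1,0,\dots,0)\in(R/\pi^{\lambda_i}R)^{\rho_i-1}$; for $i\in S$ with $\rho_i=1$ there is no block in $R_{\lambda''}$. The transitive subset of $R_\lambda^{I^*}\times R_\lambda^{I^*}$ corresponding to a $G_\lambda^I$-orbit $X\subset R_\lambda^{I^*}$ is the unique orbit of the diagonal action of $G_\lambda$ on $R_\lambda^{I^*}\times R_\lambda^{I^*}$ which contains $\{e(I)\}\times X$. *)

theory Defs
  imports "HOL-Algebra.Module" "HOL-Algebra.Ring_Divisibility" "HOL-Algebra.Group_Action"
    "HOL-Library.Extended_Nat"
begin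

section \<open>Discrete valuation rings\<close>

locale discrete_valuation_ring = principal_domain R for R (structure) +
  assumes unique_maximal: "\<exists>!P. maximalideal P R"
    and zero_not_maximal: "\<not> maximalideal {\<zero>} R"

definition uniformizer :: "('a, 'b) ring_scheme \<Rightarrow> 'a \<Rightarrow> bool" where
  "uniformizer R p \<longleftrightarrow> p \<in> carrier R \<and> maximalideal (PIdl\<^bsub>R\<^esub> p) R"

text \<open>The cyclic module \<open>R / p\<^sup>l R\<close>, as a quotient ring, and the residue class of \<open>r\<close> in it.\<close>

definition cyc :: "('a, 'b) ring_scheme \<Rightarrow> 'a \<Rightarrow> nat \<Rightarrow> 'a set ring" where
  "cyc R p l = R Quot (PIdl\<^bsub>R\<^esub> (p [^]\<^bsub>R\<^esub> l))"

definition res :: "('a, 'b) ring_scheme \<Rightarrow> 'a \<Rightarrow> nat \<Rightarrow> 'a \<Rightarrow> 'a set" where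
  "res R p l r = PIdl\<^bsub>R\<^esub> (p [^]\<^bsub>R\<^esub> l) +>\<^bsub>R\<^esub> r"

text \<open>The valuation on \<open>R / p\<^sup>l R\<close>: the largest \<open>n\<close> such that \<open>p\<^sup>n\<close> divides \<open>c\<close>. Every power
  of \<open>p\<close> divides \<open>0\<close>, so \<open>0\<close> has valuation \<open>\<infinity>\<close>, whereas a non-zero class has the valuation
  (less than \<open>l\<close>) of any of its representatives.\<close>

definition cyc_val :: "('a, 'b) ring_scheme \<Rightarrow> 'a \<Rightarrow> nat \<Rightarrow> 'a set \<Rightarrow> enat" where
  "cyc_val R p l c = (SUP n \<in> {n. res R p l (p [^]\<^bsub>R\<^esub> n) divides\<^bsub>cyc R p l\<^esub> c}. enat n)"

definition enat_pow :: "('a, 'b) ring_scheme \<Rightarrow> 'a \<Rightarrow> enat \<Rightarrow> 'a" where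
  "enat_pow R p r = (case r of enat n \<Rightarrow> p [^]\<^bsub>R\<^esub> n | \<infinity> \<Rightarrow> \<zero>\<^bsub>R\<^esub>)"

section \<open>Modules\<close>

text \<open>The module \<open>\<Oplus>\<^sub>a R / p\<^bsup>\<nu>(a)\<^esup> R\<close> over a finite index set \<open>A\<close>; its elements are
  the extensional functions on \<open>A\<close>. The ring multiplication and unit of the record type are not part
  of a module and stay unspecified (also for quotient modules).\<close>

definition cyc_sum ::
  "('a, 'b) ring_scheme \<Rightarrow> 'a \<Rightarrow> 'i set \<Rightarrow> ('i \<Rightarrow> nat) \<Rightarrow> ('a, 'i \<Rightarrow> 'a set) module" where
  "cyc_sum R p A \<nu> =
     \<lparr>carrier = (\<Pi>\<^sub>E a\<in>A. carrier (cyc R p (\<nu> a))),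
      monoid.mult = undefined, one = undefined,
      ring.zero = (\<lambda>a\<in>A. \<zero>\<^bsub>cyc R p (\<nu> a)\<^esub>),
      add = (\<lambda>x y. \<lambda>a\<in>A. x a \<oplus>\<^bsub>cyc R p (\<nu> a)\<^esub> y a),
      smult = (\<lambda>r x. \<lambda>a\<in>A. res R p (\<nu> a) r \<otimes>\<^bsub>cyc R p (\<nu> a)\<^esub> x a)\<rparr>"

definition cyc_submodule :: "('a, 'b) ring_scheme \<Rightarrow> ('a, 'm) module \<Rightarrow> 'm \<Rightarrow> 'm set" where
  "cyc_submodule R M e = {r \<odot>\<^bsub>M\<^esub> e | r. r \<in> carrier R}"

definition quot_module :: "('a, 'm) module \<Rightarrow> 'm set \<Rightarrow> ('a, 'm set) module" where
  "quot_module M N =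
     \<lparr>carrier = a_rcosets\<^bsub>M\<^esub> N,
      monoid.mult = undefined, one = undefined,
      ring.zero = N,
      add = set_add M,
      smult = (\<lambda>r X. \<Union>x\<in>X. N +>\<^bsub>M\<^esub> (r \<odot>\<^bsub>M\<^esub> x))\<rparr>"

definition module_iso ::
  "('a, 'b) ring_scheme \<Rightarrow> ('a, 'm) module \<Rightarrow> ('a, 'n) module \<Rightarrow> ('m \<Rightarrow> 'n) set" where
  "module_iso R M N =
     {h \<in> iso (add_monoid M) (add_monoid N).
        \<forall>r\<in>carrier R. \<forall>x\<in>carrier M. h (r \<odot>\<^bsub>M\<^esub> x) = r \<odot>\<^bsub>N\<^esub> h x}"

definition module_aut :: "('a, 'b) ring_scheme \<Rightarrow> ('a, 'm) module \<Rightarrow> ('m \<Rightarrow> 'm) monoid" where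
  "module_aut R M = (BijGroup (carrier M))\<lparr>carrier := Bij (carrier M) \<inter> module_iso R M M\<rparr>"

section \<open>The fundamental poset\<close>

definition fund :: "(nat \<times> nat) set" where
  "fund = {(v, l). v < l}"

definition fund_le :: "nat \<times> nat \<Rightarrow> nat \<times> nat \<Rightarrow> bool" where
  "fund_le x y \<longleftrightarrow> fst x \<ge> fst y \<and> snd x - fst x \<le> snd y - fst y"

definition order_ideal :: "(nat \<times> nat) set \<Rightarrow> bool" where
  "order_ideal I \<longleftrightarrow> I \<subseteq> fund \<and> (\<forall>x\<in>I. \<forall>y\<in>fund. fund_le y x \<longrightarrow> y \<in> I)"

definition ideal_gen :: "(nat \<times> nat) set \<Rightarrow> (nat \<times> nat) set" where
  "ideal_gen X = {y \<in> fund. \<exists>x\<in>X. fund_le y x}"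

definition max_elems :: "(nat \<times> nat) set \<Rightarrow> (nat \<times> nat) set" where
  "max_elems I = {x \<in> I. \<forall>y\<in>I. fund_le x y \<longrightarrow> y = x}"

text \<open>\<open>J(\<P>)\<^sub>\<lambda>\<close>, where \<open>L\<close> is the set of exponents of \<open>\<lambda>\<close>.\<close>

definition type_ideals :: "nat set \<Rightarrow> (nat \<times> nat) set set" where
  "type_ideals L = {I. order_ideal I \<and> max_elems I \<subseteq> {(v, l) \<in> fund. l \<in> L}}"

text \<open>The ideal \<open>[D]\<close> for the set of exponents \<open>L\<close>, and the boundary valuation
  (\<open>\<infinity>\<close> if there is none).\<close>

definition type_part :: "nat set \<Rightarrow> (nat \<times> nat) set \<Rightarrow> (nat \<times> nat) set" where
  "type_part L D = ideal_gen {(v, l) \<in> D. l \<in> L}"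

definition boundary_val :: "(nat \<times> nat) set \<Rightarrow> nat \<Rightarrow> enat" where
  "boundary_val D l = (INF v \<in> {v. (v, l) \<in> D}. enat v)"

text \<open>Replacing \<open>D\<close> by \<open>[D]\<close> does not affect the boundary valuations at the exponents
  in \<open>L\<close>.\<close>

lemma boundary_val_type_part:
  assumes "order_ideal D" and "l \<in> L"
  shows "boundary_val (type_part L D) l = boundary_val D l"
proof -
  have "(v, l) \<in> type_part L D \<longleftrightarrow> (v, l) \<in> D" for v
    using assms by (fastforce simp: type_part_def ideal_gen_def order_ideal_def fund_le_def)
  then show ?thesis
    by (simp add: boundary_val_def)
qed

section \<open>The ideal of an element\<close>

text \<open>For a given decomposition: the block of exponent \<open>l\<close> consists of the indices \<open>a \<in> A\<close>
  with \<open>\<nu> a = l\<close>. The infimum is \<open>\<infinity>\<close>, and so contributes no generator, when there is no such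
  block or when \<open>e\<close> vanishes on it.\<close>

definition sum_ideal ::
  "('a, 'b) ring_scheme \<Rightarrow> 'a \<Rightarrow> 'i set \<Rightarrow> ('i \<Rightarrow> nat) \<Rightarrow> ('i \<Rightarrow> 'a set) \<Rightarrow> (nat \<times> nat) set" where
  "sum_ideal R p A \<nu> e =
     ideal_gen {(v, l). enat v = (INF a \<in> {a \<in> A. \<nu> a = l}. cyc_val R p l (e a))}"

definition decompositions ::
  "('a, 'b) ring_scheme \<Rightarrow> 'a \<Rightarrow> ('a, 'm) module \<Rightarrow>
     ((nat \<times> nat) set \<times> (nat \<times> nat \<Rightarrow> nat) \<times> ('m \<Rightarrow> nat \<times> nat \<Rightarrow> 'a set)) set" where
  "decompositions R p M =
     {(A, \<nu>, h). finite A \<and> (\<forall>a\<in>A. 0 < \<nu> a) \<and> h \<in> module_iso R M (cyc_sum R p A \<nu>)}"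

text \<open>\<open>I(e)\<close> for \<open>e\<close> in a finite \<open>R\<close>-module \<open>M\<close>. The choice of an isomorphism depends on
  \<open>M\<close> only; since \<open>I(e)\<close> is independent of it, \<open>I(e)\<close> for a module of the form \<open>cyc_sum R p A \<nu>\<close>
  can be read off from the coordinates of \<open>e\<close>.\<close>

definition elem_ideal ::
  "('a, 'b) ring_scheme \<Rightarrow> 'a \<Rightarrow> ('a, 'm) module \<Rightarrow> 'm \<Rightarrow> (nat \<times> nat) set" where
  "elem_ideal R p M e =
     (case SOME d. d \<in> decompositions R p M of (A, \<nu>, h) \<Rightarrow> sum_ideal R p A \<nu> (h e))"

text \<open>The sets \<open>M\<^sup>I\<close> and \<open>M\<^bsup>I*\<^esup>\<close>.\<close>

definition below_ideal ::
  "('a, 'b) ring_scheme \<Rightarrow> 'a \<Rightarrow> ('a, 'm) module \<Rightarrow> (nat \<times> nat) set \<Rightarrow> 'm set" where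
  "below_ideal R p M I = {e \<in> carrier M. elem_ideal R p M e \<subseteq> I}"

definition at_ideal ::
  "('a, 'b) ring_scheme \<Rightarrow> 'a \<Rightarrow> ('a, 'm) module \<Rightarrow> (nat \<times> nat) set \<Rightarrow> 'm set" where
  "at_ideal R p M I = {e \<in> carrier M. elem_ideal R p M e = I}"

section \<open>The module of a type and its decomposition\<close>

text \<open>The \<open>j\<close>-th cyclic summand of the \<open>i\<close>-th block has the index \<open>(i, j)\<close>, with
  \<open>1 \<le> i \<le> k\<close> and \<open>1 \<le> j \<le> \<rho>\<^sub>i\<close>. As elements are functions on the index set, the projections to the
  two parts of the decomposition are restrictions of functions.\<close>

definition type_index :: "nat \<Rightarrow> (nat \<Rightarrow> nat) \<Rightarrow> (nat \<times> nat) set" where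
  "type_index k rho = (SIGMA i:{1..k}. {1..rho i})"

definition first_index :: "nat set \<Rightarrow> (nat \<times> nat) set" where
  "first_index S = S \<times> {1}"

definition rest_index :: "nat \<Rightarrow> (nat \<Rightarrow> nat) \<Rightarrow> nat set \<Rightarrow> (nat \<times> nat) set" where
  "rest_index k rho S = type_index k rho - first_index S"

definition type_module ::
  "('a, 'b) ring_scheme \<Rightarrow> 'a \<Rightarrow> (nat \<Rightarrow> nat) \<Rightarrow> (nat \<times> nat) set \<Rightarrow> ('a, nat \<times> nat \<Rightarrow> 'a set) module"
  where "type_module R p lam A = cyc_sum R p A (\<lambda>(i, j). lam i)"

definition canonical_form ::
  "('a, 'b) ring_scheme \<Rightarrow> 'a \<Rightarrow> (nat \<Rightarrow> nat) \<Rightarrow> (nat \<times> nat) set \<Rightarrow> nat set \<Rightarrow> (nat \<Rightarrow> nat) \<Rightarrow>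
     nat \<times> nat \<Rightarrow> 'a set" where
  "canonical_form R p lam A S s =
     (\<lambda>(i, j)\<in>A. res R p (lam i) (if i \<in> S \<and> j = 1 then p [^]\<^bsub>R\<^esub> s i else \<zero>\<^bsub>R\<^esub>))"

text \<open>In \<open>R\<^bsub>\<lambda>''\<^esub>\<close> the first summand of the \<open>i\<close>-th block has index \<open>(i, 2)\<close> for
  \<open>i \<in> S\<close>, since \<open>(i, 1)\<close> belongs to \<open>R\<^bsub>\<lambda>'\<^esub>\<close>; if \<open>\<rho>\<^sub>i = 1\<close> there is no such index.\<close>

definition char_elem ::
  "('a, 'b) ring_scheme \<Rightarrow> 'a \<Rightarrow> (nat \<Rightarrow> nat) \<Rightarrow> (nat \<times> nat) set \<Rightarrow> nat set \<Rightarrow> (nat \<times> nat) set \<Rightarrow>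
     nat \<times> nat \<Rightarrow> 'a set" where
  "char_elem R p lam A S D =
     (\<lambda>(i, j)\<in>A. res R p (lam i)
        (if j = (if i \<in> S then 2 else 1) then enat_pow R p (boundary_val D (lam i)) else \<zero>\<^bsub>R\<^esub>))"

section \<open>Orbits\<close>

definition stabilizer_group :: "('m \<Rightarrow> 'm) monoid \<Rightarrow> 'm \<Rightarrow> ('m \<Rightarrow> 'm) monoid" where
  "stabilizer_group G e = G\<lparr>carrier := stabilizer G (\<lambda>g. g) e\<rparr>"

text \<open>The set written \<open>\<O>\<close> with indices \<open>m', J, K\<close>; \<open>A'\<close> and \<open>A''\<close> are the index sets of the
  two parts of the decomposition.\<close>

definition orbit_set ::
  "('a, 'b) ring_scheme \<Rightarrow> 'a \<Rightarrow> (nat \<Rightarrow> nat) \<Rightarrow> (nat \<times> nat) set \<Rightarrow> (nat \<times> nat) set \<Rightarrow>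
     (nat \<times> nat \<Rightarrow> 'a set) \<Rightarrow> (nat \<times> nat) set \<Rightarrow> (nat \<times> nat) set \<Rightarrow> (nat \<times> nat \<Rightarrow> 'a set) set" where
  "orbit_set R p lam A' A'' m' J K =
     (let M = type_module R p lam (A' \<union> A'');
          M' = type_module R p lam A'; M'' = type_module R p lam A''
      in {l \<in> carrier M.
            restrict l A' \<in> m' <+\<^bsub>M'\<^esub> below_ideal R p M' (J \<union> K) \<and>
            restrict l A'' \<in> at_ideal R p M'' K <+>\<^bsub>M''\<^esub> below_ideal R p M'' J})"

text \<open>The transitive subset of \<open>E \<times> E\<close> corresponding to an orbit \<open>X \<subseteq> E\<close> of the stabilizer
  of \<open>e\<close>.\<close>

definition transitive_subset :: "('m \<Rightarrow> 'm) monoid \<Rightarrow> 'm set \<Rightarrow> 'm \<Rightarrow> 'm set \<Rightarrow> ('m \<times> 'm) set" where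
  "transitive_subset G E e X =
     (THE T. T \<in> orbits G (E \<times> E) (\<lambda>g. map_prod g g) \<and> {e} \<times> X \<subseteq> T)"

end

theory Submission
  imports Defs
begin

text \<open>A pair \<open>(v, l)\<close> lies in \<open>I(e)\<close> iff \<open>p\<^bsup>l-v-1\<^esup> e\<close> is not in \<open>p\<^sup>l M\<close>; hence
  \<open>I(e)\<close> is invariant under isomorphisms and can be read off from any decomposition.

  The units are found one coordinate at a time. As \<open>I(m) = I\<close>, the coordinate of \<open>m'\<close> in block
  \<open>i\<close> is divisible by \<open>p\<^bsup>s i\<^esup>\<close>. If the quotient is a unit, then it serves as \<open>y i\<close>. Otherwise the
  maximal element \<open>(s i, lam i)\<close> of \<open>I(m)\<close> is attained at a coordinate of \<open>m''\<close>, so it lies in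
  \<open>K\<close> and \<open>y i = 1\<close> will do. The characteristic element \<open>x\<close> is the one of the ideal \<open>K\<close> plus an
  element whose non-zero blocks are \<open>p\<^sup>b - p\<^sup>c\<close> with boundary valuations \<open>b < c\<close> of
  \<open>J \<union> K\<close> and \<open>K\<close>, so that \<open>(b, l) \<in> J\<close>. Of \<open>J\<close> only the property of being an order ideal enters,
  and the quotient of \<open>M'\<close> never has to be decomposed.\<close>

section \<open>Valuations in quotients of a discrete valuation ring\<close>

locale uniformized_dvr = discrete_valuation_ring R for R (structure) +
  fixes p :: 'a
  assumes uniformizer: "uniformizer R p"
begin

lemma p_carrier [simp, intro]: "p \<in> carrier R"
  using uniformizer by (simp add: uniformizer_def)

lemma p_pow_carrier [simp, intro]: "p [^] (n::nat) \<in> carrier R"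
  by simp

lemma p_pow_one: "p [^] Suc 0 = p"
  using nat_pow_eone[OF p_carrier] unfolding One_nat_def .

lemma p_nonzero: "p \<noteq> \<zero>"
proof
  assume "p = \<zero>"
  then have "PIdl p = {\<zero>}" by (auto simp: cgenideal_def intro!: exI[of _ \<zero>])
  then show False using uniformizer zero_not_maximal by (simp add: uniformizer_def)
qed

lemma p_pow_nonzero: "p [^] (n::nat) \<noteq> \<zero>"
  by (induction n) (auto simp: p_nonzero integral_iff)

lemma mem_PIdl_iff: "a \<in> carrier R \<Longrightarrow> r \<in> PIdl a \<longleftrightarrow> a divides r"
  by (auto simp: cgenideal_def factor_def m_comm)

lemma p_not_unit: "p \<notin> Units R"
proof
  assume "p \<in> Units R"
  then have "PIdl p = carrier R"
    using ideal_eq_carrier_iff by auto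
  moreover have "carrier R \<noteq> PIdl p"
    using uniformizer maximalideal.I_notcarr by (auto simp: uniformizer_def)
  ultimately show False by simp
qed

text \<open>A non-zero non-unit has an irreducible divisor, whose principal ideal is maximal; as
  there is only one maximal ideal, \<open>p\<close> divides that divisor.\<close>

lemma unit_iff_not_p_divides:
  assumes u: "u \<in> carrier R" shows "u \<in> Units R \<longleftrightarrow> \<not> p divides u"
proof
  show "\<not> p divides u" if "u \<in> Units R"
    using that p_not_unit divides_unit[of p u] u by auto
next
  assume nd: "\<not> p divides u"
  show "u \<in> Units R"
  proof (rule ccontr)
    assume nu: "u \<notin> Units R"
    have "p divides \<zero>" by (auto simp: factor_def intro!: bexI[of _ \<zero>])
    then have "u \<noteq> \<zero>" using nd by auto
    then obtain b where b: "b \<in> carrier R" "ring_irreducible b" "b divides u"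
      using exists_irreducible_divisor[of u] nu u by blast
    have "PIdl b = PIdl p"
      using unique_maximal irreducible_imp_maximalideal[OF b(1,2)] uniformizer
      by (auto simp: uniformizer_def)
    then have "p divides b"
      using cgenideal_self[OF b(1)] mem_PIdl_iff[of p b] by simp
    then show False using divides_trans[of p b u] b nd by simp
  qed
qed

section \<open>Divisibility by powers of the uniformizer\<close>

lemma p_pow_divides_mono: "r \<in> carrier R \<Longrightarrow> p [^] (n::nat) divides r \<Longrightarrow> m \<le> n \<Longrightarrow> p [^] m divides r"
proof -
  assume r: "r \<in> carrier R" "p [^] n divides r" and "m \<le> n"
  then have "p [^] n = p [^] m \<otimes> p [^] (n - m)" by (simp add: nat_pow_mult)
  then have "p [^] m divides p [^] n" by (metis dividesI p_pow_carrier)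
  then show ?thesis using r by (meson divides_trans p_pow_carrier)
qed

lemma p_pow_divides_add:
  assumes "a \<in> carrier R" "b \<in> carrier R" "p [^] (n::nat) divides a" "p [^] n divides b"
  shows "p [^] n divides (a \<oplus> b)"
proof -
  obtain c d where "c \<in> carrier R" "d \<in> carrier R" "a = p [^] n \<otimes> c" "b = p [^] n \<otimes> d"
    using assms(3,4) by (auto simp: factor_def)
  then show ?thesis by (auto simp: factor_def r_distr intro!: bexI[of _ "c \<oplus> d"])
qed

lemma p_pow_divides_minus:
  assumes "a \<in> carrier R" "b \<in> carrier R" "p [^] (n::nat) divides a" "p [^] n divides b"
  shows "p [^] n divides (a \<ominus> b)"
proof -
  obtain d where "d \<in> carrier R" "b = p [^] n \<otimes> d"
    using assms(4) by (auto simp: factor_def)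
  then have "p [^] n divides (\<ominus> b)" by (auto simp: factor_def r_minus intro!: bexI[of _ "\<ominus> d"])
  then show ?thesis using p_pow_divides_add[of a "\<ominus> b"] assms by (simp add: minus_eq)
qed

lemma p_pow_divides_mult_iff:
  assumes r: "r \<in> carrier R"
  shows "p [^] (n + d :: nat) divides (p [^] d \<otimes> r) \<longleftrightarrow> p [^] n divides r"
proof -
  have eq: "p [^] (n + d) \<otimes> c = p [^] d \<otimes> (p [^] n \<otimes> c)" if "c \<in> carrier R" for c
    using that by (simp add: nat_pow_mult[symmetric] m_ac)
  have "p [^] d \<otimes> r = p [^] d \<otimes> (p [^] n \<otimes> c) \<longleftrightarrow> r = p [^] n \<otimes> c" if "c \<in> carrier R" for c
    using that r p_pow_nonzero m_lcancel by simp
  with eq show ?thesis by (auto simp: factor_def)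
qed

text \<open>The hypotheses fix the valuation of \<open>r\<close> as \<open>w\<close>; multiplication
  by \<open>p [^] d\<close> shifts it to \<open>d + w\<close>.\<close>

lemma p_pow_divides_exact:
  assumes r: "r \<in> carrier R" and "p [^] (w::nat) divides r" "\<not> p [^] Suc w divides r"
  shows "p [^] m divides (p [^] (d::nat) \<otimes> r) \<longleftrightarrow> m \<le> d + w"
proof
  assume "m \<le> d + w"
  moreover have "p [^] (w + d) divides (p [^] d \<otimes> r)"
    using p_pow_divides_mult_iff assms by blast
  ultimately show "p [^] m divides (p [^] d \<otimes> r)"
    using p_pow_divides_mono r by (metis add.commute m_closed p_pow_carrier)
next
  assume div: "p [^] m divides (p [^] d \<otimes> r)"
  show "m \<le> d + w"
  proof (rule ccontr)
    assume "\<not> m \<le> d + w"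
    then have "Suc w + d \<le> m" by simp
    then have "p [^] (Suc w + d) divides (p [^] d \<otimes> r)"
      using div p_pow_divides_mono r by blast
    then show False using p_pow_divides_mult_iff assms by blast
  qed
qed

lemma one_divides: "r \<in> carrier R \<Longrightarrow> \<one> divides r"
  by (rule dividesI[of r]) simp_all

lemma p_pow_divides_p_pow: "p [^] (m::nat) divides (p [^] (n::nat)) \<longleftrightarrow> m \<le> n"
proof -
  have not_div: "\<not> p [^] Suc 0 divides \<one>"
    using unit_iff_not_p_divides[OF one_closed] Units_one_closed p_pow_one by metis
  have "p [^] (0::nat) divides \<one>"
    using one_divides[OF one_closed] nat_pow_0[of p] by metis
  from p_pow_divides_exact[OF one_closed this not_div, of m n] show ?thesis
    unfolding r_one[OF p_pow_carrier] add_0_right .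
qed

lemma p_pow_divides_zero: "p [^] (m::nat) divides \<zero>"
  by (auto simp: factor_def intro!: bexI[of _ \<zero>])

section \<open>Residue classes and their valuations\<close>

lemma ideal_p_pow: "ideal (PIdl (p [^] (l::nat))) R"
  by (simp add: cgenideal_ideal)

lemma res_eq_iff:
  assumes "a \<in> carrier R" "b \<in> carrier R"
  shows "res R p l a = res R p l b \<longleftrightarrow> p [^] l divides (a \<ominus> b)"
  unfolding res_def
  using quotient_eq_iff_same_a_r_cos[OF ideal_p_pow[of l] assms] mem_PIdl_iff[of "p [^] l"]
  by simp

lemma cring_cyc: "cring (cyc R p l)"
  unfolding cyc_def by (intro ideal.quotient_is_cring ideal_p_pow) (rule is_cring)

lemma res_hom: "res R p l \<in> ring_hom R (cyc R p l)"
proof -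
  have "(+>) (PIdl (p [^] l)) = res R p l" by (auto simp: res_def fun_eq_iff)
  then show ?thesis using ideal.rcos_ring_hom[OF ideal_p_pow[of l]] by (simp add: cyc_def)
qed

lemma carrier_cyc: "carrier (cyc R p l) = res R p l ` carrier R"
  by (auto simp: cyc_def FactRing_simps res_def)

lemma res_mult:
  "a \<in> carrier R \<Longrightarrow> b \<in> carrier R \<Longrightarrow> res R p l a \<otimes>\<^bsub>cyc R p l\<^esub> res R p l b = res R p l (a \<otimes> b)"
  using ring_hom_mult[OF res_hom] by simp

lemma res_add:
  "a \<in> carrier R \<Longrightarrow> b \<in> carrier R \<Longrightarrow> res R p l a \<oplus>\<^bsub>cyc R p l\<^esub> res R p l b = res R p l (a \<oplus> b)"
  using ring_hom_add[OF res_hom] by simp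

text \<open>The multiples of the class of \<open>p [^] n\<close> pull back to the ideal generated by
  \<open>p [^] n\<close> and \<open>p [^] l\<close>, which the power with the smaller exponent
  generates.\<close>

lemma res_divides_iff:
  assumes r: "r \<in> carrier R"
  shows "res R p l (p [^] (n::nat)) divides\<^bsub>cyc R p l\<^esub> res R p l r \<longleftrightarrow> p [^] min n l divides r"
proof
  assume "res R p l (p [^] n) divides\<^bsub>cyc R p l\<^esub> res R p l r"
  then obtain c where c: "c \<in> carrier R" and "res R p l r = res R p l (p [^] n \<otimes> c)"
    by (auto simp: factor_def carrier_cyc res_mult)
  then have "p [^] l divides (r \<ominus> p [^] n \<otimes> c)" using r by (simp add: res_eq_iff)
  then have "p [^] min n l divides (r \<ominus> p [^] n \<otimes> c)"
    using c r p_pow_divides_mono[of _ l "min n l"] by simp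
  moreover have "p [^] n divides (p [^] n \<otimes> c)" using c by (auto simp: factor_def)
  then have "p [^] min n l divides (p [^] n \<otimes> c)"
    using c p_pow_divides_mono[of _ n "min n l"] by simp
  ultimately have "p [^] min n l divides ((r \<ominus> p [^] n \<otimes> c) \<oplus> p [^] n \<otimes> c)"
    using c r p_pow_divides_add by simp
  moreover have "(r \<ominus> p [^] n \<otimes> c) \<oplus> p [^] n \<otimes> c = r"
    using c r by (simp add: minus_eq a_assoc l_neg)
  ultimately show "p [^] min n l divides r" by simp
next
  assume div: "p [^] min n l divides r"
  show "res R p l (p [^] n) divides\<^bsub>cyc R p l\<^esub> res R p l r"
  proof (cases "n \<le> l")
    case True
    then obtain c where "c \<in> carrier R" "r = p [^] n \<otimes> c" using div by (auto simp: factor_def)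
    then show ?thesis by (auto simp: factor_def carrier_cyc res_mult[symmetric])
  next
    case False
    \<comment> \<open>Here the class of \<open>r\<close> is zero, so zero serves as
      cofactor.\<close>
    then have "p [^] l divides (r \<ominus> p [^] n \<otimes> \<zero>)" using div r by (simp add: minus_eq)
    then have "res R p l r = res R p l (p [^] n \<otimes> \<zero>)"
      using r by (subst res_eq_iff) auto
    also have "\<dots> = res R p l (p [^] n) \<otimes>\<^bsub>cyc R p l\<^esub> res R p l \<zero>" by (simp add: res_mult)
    finally show ?thesis using carrier_cyc[of l] by (auto simp: factor_def)
  qed
qed

text \<open>The exponents in the supremum form a down-closed set, so the bound \<open>w\<close>
  holds iff \<open>Suc w\<close> is missing. The minimum with \<open>l\<close> accounts for the zero
  class, which every power divides.\<close>

lemma cyc_val_le_iff: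
  assumes r: "r \<in> carrier R"
  shows "cyc_val R p l (res R p l r) \<le> enat w \<longleftrightarrow> \<not> p [^] min (Suc w) l divides r"
proof -
  have "cyc_val R p l (res R p l r) = (SUP n \<in> {n. p [^] min n l divides r}. enat n)"
    using r by (simp add: cyc_val_def res_divides_iff)
  also have "\<dots> \<le> enat w \<longleftrightarrow> (\<forall>n. p [^] min n l divides r \<longrightarrow> n \<le> w)"
    by (auto simp: SUP_le_iff)
  also have "\<dots> \<longleftrightarrow> \<not> p [^] min (Suc w) l divides r"
  proof (intro iffI allI impI)
    fix n assume "\<not> p [^] min (Suc w) l divides r" "p [^] min n l divides r"
    then have "\<not> min (Suc w) l \<le> min n l" using p_pow_divides_mono r by blast
    then show "n \<le> w" by linarith
  qed (meson not_less_eq_eq order_refl)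
  finally show ?thesis .
qed

lemma cyc_val_eq_iff:
  assumes r: "r \<in> carrier R"
  shows "cyc_val R p l (res R p l r) = enat w \<longleftrightarrow>
    w < l \<and> p [^] w divides r \<and> \<not> p [^] Suc w divides r"
proof -
  have "cyc_val R p l (res R p l r) = enat w \<longleftrightarrow>
    cyc_val R p l (res R p l r) \<le> enat w \<and> (\<forall>w'<w. \<not> cyc_val R p l (res R p l r) \<le> enat w')"
    by (cases "cyc_val R p l (res R p l r)") (auto simp: not_le order.order_iff_strict)
  also have "\<dots> \<longleftrightarrow> \<not> p [^] min (Suc w) l divides r \<and> (\<forall>w'<w. p [^] min (Suc w') l divides r)"
    using r by (simp add: cyc_val_le_iff)
  also have "\<dots> \<longleftrightarrow> w < l \<and> p [^] w divides r \<and> \<not> p [^] Suc w divides r" (is "?L \<longleftrightarrow> ?R")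
  proof
    assume L: ?L
    \<comment> \<open>This is the failed bound at \<open>w - 1\<close>; for \<open>w = 0\<close> the
      divisor is one.\<close>
    have d: "p [^] min w l divides r"
    proof (cases w)
      case 0 then show ?thesis using r by (simp add: one_divides)
    next
      case (Suc w') then show ?thesis using L by blast
    qed
    \<comment> \<open>If \<open>l \<le> w\<close>, both minima equal \<open>l\<close>, and
      \<open>d\<close> contradicts the bound at \<open>w\<close>.\<close>
    have "w < l"
    proof (rule ccontr)
      assume "\<not> w < l"
      then have "min (Suc w) l = min w l" by simp
      then show False using L d by metis
    qed
    then have "min w l = w" "min (Suc w) l = Suc w" by simp_all
    then show ?R using L d \<open>w < l\<close> by metis
  next
    assume R: ?R
    then have "min (Suc w) l = Suc w" by simp
    moreover have "p [^] min (Suc w') l divides r" if "w' < w" for w'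
      using p_pow_divides_mono[OF r, of w "min (Suc w') l"] R that by simp
    ultimately show ?L using R by simp
  qed
  finally show ?thesis .
qed

lemma cyc_val_eq_infinity_iff:
  assumes r: "r \<in> carrier R"
  shows "cyc_val R p l (res R p l r) = \<infinity> \<longleftrightarrow> p [^] l divides r"
proof
  assume "p [^] l divides r"
  then have "\<not> cyc_val R p l (res R p l r) \<le> enat w" for w
    using cyc_val_le_iff[OF r] p_pow_divides_mono[OF r] by simp
  then show "cyc_val R p l (res R p l r) = \<infinity>"
    by (cases "cyc_val R p l (res R p l r)") auto
next
  assume inf: "cyc_val R p l (res R p l r) = \<infinity>"
  then have "p [^] min (Suc l) l divides r" using cyc_val_le_iff[OF r, of l l] by simp
  then show "p [^] l divides r" by simp
qed

text \<open>Serves for the canonical form and the characteristic element alike: an exponent that is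
  infinite or at least \<open>l\<close> yields the zero class.\<close>

lemma cyc_val_p_pow:
  "cyc_val R p l (res R p l (enat_pow R p v)) = (if v < enat l then v else \<infinity>)"
proof (cases v)
  case (enat n)
  have "\<not> p [^] Suc n divides (p [^] n)" "p [^] n divides (p [^] n)"
    unfolding p_pow_divides_p_pow by simp_all
  moreover have "p [^] l divides (p [^] n) \<longleftrightarrow> l \<le> n"
    by (rule p_pow_divides_p_pow)
  ultimately show ?thesis
    using enat cyc_val_eq_iff[of "p [^] n" l n] cyc_val_eq_infinity_iff[of "p [^] n" l]
    by (simp add: enat_pow_def del: nat_pow_Suc)
next
  case infinity
  then show ?thesis
    using cyc_val_eq_infinity_iff[of \<zero> l] p_pow_divides_zero by (simp add: enat_pow_def)
qed

end

section \<open>Intrinsic description of the ideal of an element\<close>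

lemma enat_Inf_mem: "B \<noteq> {} \<Longrightarrow> Inf B \<in> (B :: enat set)"
  unfolding Inf_enat_def by (metis LeastI ex_in_conv)

lemma fund_le_trans: "fund_le x y \<Longrightarrow> fund_le y z \<Longrightarrow> fund_le x z"
  by (auto simp: fund_le_def)

lemma order_ideal_ideal_gen: "order_ideal (ideal_gen X)"
  unfolding order_ideal_def ideal_gen_def by (blast intro: fund_le_trans)

lemma order_ideal_Un: "order_ideal I \<Longrightarrow> order_ideal J \<Longrightarrow> order_ideal (I \<union> J)"
  by (auto simp: order_ideal_def)

lemma ideal_gen_subset_iff:
  assumes "order_ideal D" "X \<subseteq> fund"
  shows "ideal_gen X \<subseteq> D \<longleftrightarrow> X \<subseteq> D"
proof
  have "X \<subseteq> ideal_gen X" using assms(2) by (auto simp: ideal_gen_def fund_le_def)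
  then show "X \<subseteq> D" if "ideal_gen X \<subseteq> D" using that by blast
  show "ideal_gen X \<subseteq> D" if "X \<subseteq> D"
    using that assms(1) by (auto simp: ideal_gen_def order_ideal_def)
qed

lemma ideal_gen_eqI:
  assumes "order_ideal D" "X \<subseteq> D" "\<And>y. y \<in> D \<Longrightarrow> \<exists>x\<in>X. fund_le y x"
  shows "ideal_gen X = D"
  using assms by (auto simp: ideal_gen_def order_ideal_def)

text \<open>Only scalar multiplication occurs, so that isomorphisms visibly preserve this set. On
  \<open>fund\<close> the truncated difference \<open>l - v - 1\<close> is exact.\<close>

definition height_ideal ::
  "('a, 'b) ring_scheme \<Rightarrow> 'a \<Rightarrow> ('a, 'm) module \<Rightarrow> 'm \<Rightarrow> (nat \<times> nat) set" where
  "height_ideal R p M e =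
     {(v, l) \<in> fund. \<not> (\<exists>z\<in>carrier M. (p [^]\<^bsub>R\<^esub> (l - v - 1)) \<odot>\<^bsub>M\<^esub> e = (p [^]\<^bsub>R\<^esub> l) \<odot>\<^bsub>M\<^esub> z)}"

text \<open>Within a block a larger valuation gives a smaller element of the poset, and the minimum
  is attained; so all coordinates generate the same ideal as the block minima.\<close>

lemma sum_ideal_eq:
  "sum_ideal R p A \<nu> e = ideal_gen {(w, \<nu> a) |w a. a \<in> A \<and> cyc_val R p (\<nu> a) (e a) = enat w}"
    (is "_ = ideal_gen ?X")
proof -
  let ?B = "\<lambda>l. {a \<in> A. \<nu> a = l}"
  let ?Y = "{(v, l). enat v = (INF a \<in> ?B l. cyc_val R p l (e a))}"
  have "\<exists>x\<in>?X. y = x" if mem: "y \<in> ?Y" for y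
  proof -
    obtain v l where y: "y = (v, l)" and v: "enat v = (INF a \<in> ?B l. cyc_val R p l (e a))"
      using mem by (cases y) simp
    \<comment> \<open>An empty block has infimum \<infinity>, which is not
      \<open>enat v\<close>.\<close>
    then have ne: "?B l \<noteq> {}" by (auto simp: Inf_enat_def split: if_splits)
    then have "(INF a \<in> ?B l. cyc_val R p l (e a)) \<in> (\<lambda>a. cyc_val R p l (e a)) ` ?B l"
      by (intro enat_Inf_mem) simp
    then show ?thesis using y v by (auto simp del: Collect_empty_eq)
  qed
  then have sub: "?Y \<subseteq> ?X" by blast
  have below: "\<exists>y\<in>?Y. fund_le x y" if mem: "x \<in> ?X" for x
  proof -
    obtain w a where x: "x = (w, \<nu> a)" "a \<in> A" "cyc_val R p (\<nu> a) (e a) = enat w"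
      using mem by auto
    let ?v = "INF b \<in> ?B (\<nu> a). cyc_val R p (\<nu> a) (e b)"
    have "?v \<le> cyc_val R p (\<nu> a) (e a)"
      by (rule INF_lower) (use x in simp)
    then obtain v where v: "?v = enat v" "v \<le> w"
      unfolding x(3) by (cases ?v) auto
    have "(v, \<nu> a) \<in> ?Y" unfolding mem_Collect_eq prod.case by (rule v(1)[symmetric])
    moreover have "fund_le x (v, \<nu> a)" using v(2) by (simp add: x(1) fund_le_def diff_le_mono2)
    ultimately show ?thesis by blast
  qed
  have "ideal_gen ?Y = ideal_gen ?X"
  proof
    show "ideal_gen ?Y \<subseteq> ideal_gen ?X" using sub unfolding ideal_gen_def by blast
    show "ideal_gen ?X \<subseteq> ideal_gen ?Y"
    proof
      fix z assume "z \<in> ideal_gen ?X"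
      then obtain x where x: "z \<in> fund" "x \<in> ?X" "fund_le z x"
        unfolding ideal_gen_def by blast
      then obtain y where "y \<in> ?Y" "fund_le x y" using below by blast
      then show "z \<in> ideal_gen ?Y"
        using x(1) fund_le_trans[OF x(3)] unfolding ideal_gen_def by blast
    qed
  qed
  then show ?thesis unfolding sum_ideal_def .
qed

text \<open>Whatever triple the choice operator returns, \<open>sum_ideal\<close> is a generated
  ideal; so no decomposition of \<open>M\<close> has to be exhibited. This covers the quotient
  module that defines \<open>J\<close>.\<close>

lemma order_ideal_elem_ideal: "order_ideal (elem_ideal R p M e)"
  by (auto simp: elem_ideal_def sum_ideal_eq order_ideal_ideal_gen split: prod.split)

context uniformized_dvr
begin

text \<open>The case of a single cyclic summand, to which a direct sum reduces coordinate by
  coordinate.\<close>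

lemma coordinate_height:
  assumes c: "c \<in> carrier (cyc R p n)" and "v < l"
  shows "(\<exists>w. cyc_val R p n c = enat w \<and> fund_le (v, l) (w, n)) \<longleftrightarrow>
    \<not> (\<exists>z\<in>carrier (cyc R p n).
        res R p n (p [^] (l - v - 1)) \<otimes>\<^bsub>cyc R p n\<^esub> c = res R p n (p [^] l) \<otimes>\<^bsub>cyc R p n\<^esub> z)"
proof -
  define d where "d = l - v - 1"
  obtain r where r: "r \<in> carrier R" and cr: "c = res R p n r"
    using c by (auto simp: carrier_cyc)
  have "(\<exists>z\<in>carrier (cyc R p n).
        res R p n (p [^] d) \<otimes>\<^bsub>cyc R p n\<^esub> c = res R p n (p [^] l) \<otimes>\<^bsub>cyc R p n\<^esub> z)
      \<longleftrightarrow> p [^] min l n divides (p [^] d \<otimes> r)"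
    using r res_divides_iff[of "p [^] d \<otimes> r" n l] by (simp add: cr res_mult factor_def)
  also have "\<dots> \<longleftrightarrow> \<not> (\<exists>w. cyc_val R p n c = enat w \<and> fund_le (v, l) (w, n))"
  proof (cases "cyc_val R p n c")
    case (enat w)
    then have w: "w < n" "p [^] w divides r" "\<not> p [^] Suc w divides r"
      using cyc_val_eq_iff[OF r] cr by blast+
    have "p [^] min l n divides (p [^] d \<otimes> r) \<longleftrightarrow> min l n \<le> d + w"
      by (rule p_pow_divides_exact[OF r w(2,3)])
    \<comment> \<open>The negated inequality \<open>d + w < min l n\<close> splits into
      \<open>w \<le> v\<close> and \<open>l - v \<le> n - w\<close>.\<close>
    also have "\<dots> \<longleftrightarrow> \<not> (w \<le> v \<and> l - v \<le> n - w)"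
      using \<open>v < l\<close> w(1) by (auto simp: d_def min_def)
    finally show ?thesis using enat by (simp add: fund_le_def)
  next
    case infinity
    \<comment> \<open>A zero coordinate solves every such equation and contributes no
      generator.\<close>
    then have "p [^] n divides r" using cyc_val_eq_infinity_iff[OF r] cr by blast
    then have "p [^] (n + d) divides (p [^] d \<otimes> r)" using p_pow_divides_mult_iff[OF r] by blast
    then have "p [^] min l n divides (p [^] d \<otimes> r)"
      using p_pow_divides_mono[of "p [^] d \<otimes> r" "n + d" "min l n"] r by simp
    then show ?thesis using infinity by simp
  qed
  finally show ?thesis unfolding d_def by blast
qed

text \<open>Scalars act coordinatewise, so solvability in the direct sum is solvability in every
  summand.\<close>

lemma sum_ideal_eq_height_ideal:
  assumes e: "e \<in> carrier (cyc_sum R p A \<nu>)"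
  shows "sum_ideal R p A \<nu> e = height_ideal R p (cyc_sum R p A \<nu>) e"
proof -
  let ?M = "cyc_sum R p A \<nu>"
  have "(v, l) \<in> sum_ideal R p A \<nu> e \<longleftrightarrow> (v, l) \<in> height_ideal R p ?M e" if vl: "v < l" for v l
  proof -
    let ?eq = "\<lambda>a z. res R p (\<nu> a) (p [^] (l - v - 1)) \<otimes>\<^bsub>cyc R p (\<nu> a)\<^esub> e a
                   = res R p (\<nu> a) (p [^] l) \<otimes>\<^bsub>cyc R p (\<nu> a)\<^esub> z"
    have "(v, l) \<in> sum_ideal R p A \<nu> e \<longleftrightarrow>
        (\<exists>a\<in>A. \<exists>w. cyc_val R p (\<nu> a) (e a) = enat w \<and> fund_le (v, l) (w, \<nu> a))"
      using vl by (auto simp: sum_ideal_eq ideal_gen_def fund_def)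
    also have "\<dots> \<longleftrightarrow> (\<exists>a\<in>A. \<not> (\<exists>z\<in>carrier (cyc R p (\<nu> a)). ?eq a z))"
      by (intro bex_cong refl coordinate_height[OF _ vl]) (use e in \<open>auto simp: cyc_sum_def\<close>)
    also have "\<dots> \<longleftrightarrow> \<not> (\<exists>z\<in>carrier ?M. \<forall>a\<in>A. ?eq a (z a))"
    proof -
      have "(\<forall>a\<in>A. \<exists>z\<in>carrier (cyc R p (\<nu> a)). ?eq a z) \<longleftrightarrow> (\<exists>z\<in>carrier ?M. \<forall>a\<in>A. ?eq a (z a))"
      proof
        assume "\<forall>a\<in>A. \<exists>z\<in>carrier (cyc R p (\<nu> a)). ?eq a z"
        then obtain f where "\<forall>a\<in>A. f a \<in> carrier (cyc R p (\<nu> a)) \<and> ?eq a (f a)" by metis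
        then show "\<exists>z\<in>carrier ?M. \<forall>a\<in>A. ?eq a (z a)"
          by (intro bexI[of _ "restrict f A"]) (auto simp: cyc_sum_def)
      qed (auto simp: cyc_sum_def PiE_iff)
      then show ?thesis by blast
    qed
    also have "\<dots> \<longleftrightarrow> (v, l) \<in> height_ideal R p ?M e"
      using vl by (auto simp: height_ideal_def fund_def cyc_sum_def restrict_def fun_eq_iff; metis)
    finally show ?thesis .
  qed
  moreover have "v < l"
    if "(v, l) \<in> sum_ideal R p A \<nu> e \<or> (v, l) \<in> height_ideal R p ?M e" for v l
    using that by (auto simp: height_ideal_def sum_ideal_def ideal_gen_def fund_def)
  ultimately have "(v, l) \<in> sum_ideal R p A \<nu> e \<longleftrightarrow> (v, l) \<in> height_ideal R p ?M e" for v l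
    by blast
  then show ?thesis by auto
qed

text \<open>An isomorphism carries the defining equations over to \<open>N\<close>. As
  \<open>M\<close> is an arbitrary record, closure under scalars is assumed: injectivity of
  \<open>h\<close> is available on the carrier only.\<close>

lemma height_ideal_iso:
  assumes h: "h \<in> module_iso R M N" and e: "e \<in> carrier M"
    and closed: "\<And>r z. r \<in> carrier R \<Longrightarrow> z \<in> carrier M \<Longrightarrow> r \<odot>\<^bsub>M\<^esub> z \<in> carrier M"
  shows "height_ideal R p N (h e) = height_ideal R p M e"
proof -
  have smult: "h (r \<odot>\<^bsub>M\<^esub> z) = r \<odot>\<^bsub>N\<^esub> h z" if "r \<in> carrier R" "z \<in> carrier M" for r z
    using h that by (simp add: module_iso_def)
  have bij: "bij_betw h (carrier M) (carrier N)"
    using h by (simp add: module_iso_def iso_def)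
  have "(\<exists>z\<in>carrier N. p [^] (d::nat) \<odot>\<^bsub>N\<^esub> h e = p [^] (l::nat) \<odot>\<^bsub>N\<^esub> z) \<longleftrightarrow>
        (\<exists>z\<in>carrier M. p [^] d \<odot>\<^bsub>M\<^esub> e = p [^] l \<odot>\<^bsub>M\<^esub> z)" for d l
  proof -
    have "(\<exists>z\<in>carrier N. p [^] d \<odot>\<^bsub>N\<^esub> h e = p [^] l \<odot>\<^bsub>N\<^esub> z) \<longleftrightarrow>
          (\<exists>z\<in>carrier M. p [^] d \<odot>\<^bsub>N\<^esub> h e = p [^] l \<odot>\<^bsub>N\<^esub> h z)"
      using bij_betw_imp_surj_on[OF bij, symmetric] by simp
    also have "\<dots> \<longleftrightarrow> (\<exists>z\<in>carrier M. h (p [^] d \<odot>\<^bsub>M\<^esub> e) = h (p [^] l \<odot>\<^bsub>M\<^esub> z))"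
      using smult e by simp
    also have "\<dots> \<longleftrightarrow> (\<exists>z\<in>carrier M. p [^] d \<odot>\<^bsub>M\<^esub> e = p [^] l \<odot>\<^bsub>M\<^esub> z)"
      using bij closed e by (intro bex_cong refl) (auto simp: bij_betw_def inj_on_eq_iff)
    finally show ?thesis .
  qed
  then show ?thesis by (simp add: height_ideal_def)
qed

lemma smult_cyc_sum_closed:
  assumes "r \<in> carrier R" "z \<in> carrier (cyc_sum R p A \<nu>)"
  shows "r \<odot>\<^bsub>cyc_sum R p A \<nu>\<^esub> z \<in> carrier (cyc_sum R p A \<nu>)"
proof -
  have "res R p l r \<otimes>\<^bsub>cyc R p l\<^esub> c \<in> carrier (cyc R p l)" if "c \<in> carrier (cyc R p l)" for l c
    using that assms(1) by (auto simp: carrier_cyc res_mult)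
  then show ?thesis using assms(2) by (auto simp: cyc_sum_def)
qed

text \<open>The choice ranges over index sets of pairs of naturals, so for such an \<open>A\<close>
  the identity is a candidate and the chosen triple is a genuine decomposition. Its isomorphism
  preserves the height ideal.\<close>

lemma elem_ideal_eq_height_ideal:
  fixes A :: "(nat \<times> nat) set"
  assumes "finite A" "\<forall>a\<in>A. 0 < \<nu> a" and e: "e \<in> carrier (cyc_sum R p A \<nu>)"
  shows "elem_ideal R p (cyc_sum R p A \<nu>) e = height_ideal R p (cyc_sum R p A \<nu>) e"
proof -
  let ?M = "cyc_sum R p A \<nu>"
  have "id \<in> module_iso R ?M ?M" by (auto simp: module_iso_def iso_def hom_def)
  then have "(A, \<nu>, id) \<in> decompositions R p ?M" using assms by (simp add: decompositions_def)
  then have "(SOME d. d \<in> decompositions R p ?M) \<in> decompositions R p ?M" by (rule someI)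
  then obtain B \<mu> h where d: "(SOME d. d \<in> decompositions R p ?M) = (B, \<mu>, h)"
      and h: "h \<in> module_iso R ?M (cyc_sum R p B \<mu>)"
    by (auto simp: decompositions_def)
  have "h e \<in> carrier (cyc_sum R p B \<mu>)"
    using h e by (auto simp: module_iso_def iso_def bij_betw_def)
  then have "elem_ideal R p ?M e = height_ideal R p (cyc_sum R p B \<mu>) (h e)"
    by (simp add: elem_ideal_def d sum_ideal_eq_height_ideal)
  also have "\<dots> = height_ideal R p ?M e"
    using h e smult_cyc_sum_closed by (rule height_ideal_iso)
  finally show ?thesis .
qed

lemma elem_ideal_cyc_sum:
  fixes A :: "(nat \<times> nat) set"
  assumes "finite A" "\<forall>a\<in>A. 0 < \<nu> a" "e \<in> carrier (cyc_sum R p A \<nu>)"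
  shows "elem_ideal R p (cyc_sum R p A \<nu>) e =
    ideal_gen {(w, \<nu> a) |w a. a \<in> A \<and> cyc_val R p (\<nu> a) (e a) = enat w}"
  unfolding sum_ideal_eq[symmetric]
  using assms by (simp add: elem_ideal_eq_height_ideal sum_ideal_eq_height_ideal)

lemma cyc_val_enat_less:
  "c \<in> carrier (cyc R p l) \<Longrightarrow> cyc_val R p l c = enat w \<Longrightarrow> w < l"
  by (auto simp: carrier_cyc cyc_val_eq_iff)

text \<open>Turns membership in \<open>below_ideal\<close> into a condition on single coordinates.
  Finite valuations modulo \<open>p [^] n\<close> are less than \<open>n\<close>, so the generators
  do lie in \<open>fund\<close>.\<close>

lemma elem_ideal_cyc_sum_subset_iff:
  fixes A :: "(nat \<times> nat) set"
  assumes "finite A" "\<forall>a\<in>A. 0 < \<nu> a" "e \<in> carrier (cyc_sum R p A \<nu>)" "order_ideal D"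
  shows "elem_ideal R p (cyc_sum R p A \<nu>) e \<subseteq> D \<longleftrightarrow>
    (\<forall>a\<in>A. \<forall>w. cyc_val R p (\<nu> a) (e a) = enat w \<longrightarrow> (w, \<nu> a) \<in> D)"
proof -
  have "{(w, \<nu> a) |w a. a \<in> A \<and> cyc_val R p (\<nu> a) (e a) = enat w} \<subseteq> fund" (is "?X \<subseteq> _")
    using assms(3) by (fastforce simp: cyc_sum_def fund_def dest: cyc_val_enat_less)
  then show ?thesis
    using assms elem_ideal_cyc_sum[OF assms(1-3)] ideal_gen_subset_iff[of D ?X] by blast
qed

text \<open>Invariance of the height ideal; it makes each \<open>at_ideal\<close> set stable under
  automorphisms.\<close>

lemma elem_ideal_automorphism:
  fixes A :: "(nat \<times> nat) set"
  assumes "finite A" "\<forall>a\<in>A. 0 < \<nu> a" and M: "M = cyc_sum R p A \<nu>"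
    and g: "g \<in> carrier (module_aut R M)" and e: "e \<in> carrier M"
  shows "g e \<in> carrier M" "elem_ideal R p M (g e) = elem_ideal R p M e"
proof -
  have iso: "g \<in> module_iso R M M" and "g \<in> Bij (carrier M)"
    using g by (simp_all add: module_aut_def)
  then show gc: "g e \<in> carrier M" using e by (auto simp: Bij_def bij_betw_def)
  have "height_ideal R p M (g e) = height_ideal R p M e"
    using iso e smult_cyc_sum_closed unfolding M by (rule height_ideal_iso)
  then show "elem_ideal R p M (g e) = elem_ideal R p M e"
    using elem_ideal_eq_height_ideal[OF assms(1,2)] gc e by (simp add: M)
qed

end

section \<open>Orbits of the automorphism group\<close>

lemma carrier_module_aut_iff:
  "g \<in> carrier (module_aut R M) \<longleftrightarrow>
     g \<in> extensional (carrier M) \<and> bij_betw g (carrier M) (carrier M) \<and>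
     (\<forall>x\<in>carrier M. \<forall>y\<in>carrier M. g (x \<oplus>\<^bsub>M\<^esub> y) = g x \<oplus>\<^bsub>M\<^esub> g y) \<and>
     (\<forall>r\<in>carrier R. \<forall>x\<in>carrier M. g (r \<odot>\<^bsub>M\<^esub> x) = r \<odot>\<^bsub>M\<^esub> g x)"
  by (auto simp: module_aut_def Bij_def module_iso_def iso_def hom_def bij_betw_def)

lemma module_aut_compose:
  assumes "\<And>x y. x \<in> carrier M \<Longrightarrow> y \<in> carrier M \<Longrightarrow> x \<oplus>\<^bsub>M\<^esub> y \<in> carrier M"
    and "\<And>r x. r \<in> carrier R \<Longrightarrow> x \<in> carrier M \<Longrightarrow> r \<odot>\<^bsub>M\<^esub> x \<in> carrier M"
    and g: "g \<in> carrier (module_aut R M)" and h: "h \<in> carrier (module_aut R M)"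
  shows "compose (carrier M) g h \<in> carrier (module_aut R M)"
proof -
  have "h x \<in> carrier M" if "x \<in> carrier M" for x
    using h that by (auto simp: carrier_module_aut_iff bij_betw_def)
  moreover have "bij_betw (compose (carrier M) g h) (carrier M) (carrier M)"
    using g h by (auto simp: carrier_module_aut_iff intro: bij_betw_compose)
  ultimately show ?thesis
    using assms by (simp add: carrier_module_aut_iff compose_eq)
qed

lemma module_aut_inverse:
  assumes add: "\<And>x y. x \<in> carrier M \<Longrightarrow> y \<in> carrier M \<Longrightarrow> x \<oplus>\<^bsub>M\<^esub> y \<in> carrier M"
    and smult: "\<And>r x. r \<in> carrier R \<Longrightarrow> x \<in> carrier M \<Longrightarrow> r \<odot>\<^bsub>M\<^esub> x \<in> carrier M"
    and g: "g \<in> carrier (module_aut R M)"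
  obtains h where "h \<in> carrier (module_aut R M)" "\<And>x. x \<in> carrier M \<Longrightarrow> h (g x) = x"
proof
  \<comment> \<open>\<open>Bij\<close> consists of extensional functions, hence the
    restriction.\<close>
  let ?h = "restrict (inv_into (carrier M) g) (carrier M)"
  have bij: "bij_betw g (carrier M) (carrier M)" using g by (simp add: carrier_module_aut_iff)
  then have gc: "g x \<in> carrier M" if "x \<in> carrier M" for x using that by (auto simp: bij_betw_def)
  show hg: "?h (g x) = x" if "x \<in> carrier M" for x
    using bij gc that by (simp add: bij_betw_inv_into_left)
  have surj: "\<exists>x'\<in>carrier M. x = g x'" if "x \<in> carrier M" for x
    using bij that by (auto simp: bij_betw_def)
  have "?h (x \<oplus>\<^bsub>M\<^esub> y) = ?h x \<oplus>\<^bsub>M\<^esub> ?h y" if xy: "x \<in> carrier M" "y \<in> carrier M" for x y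
  proof -
    obtain a b where ab: "a \<in> carrier M" "b \<in> carrier M" "x = g a" "y = g b"
      using surj xy by blast
    then have "g (a \<oplus>\<^bsub>M\<^esub> b) = x \<oplus>\<^bsub>M\<^esub> y" using g by (simp add: carrier_module_aut_iff)
    then show ?thesis using hg[of "a \<oplus>\<^bsub>M\<^esub> b"] hg[of a] hg[of b] ab add by metis
  qed
  moreover have "?h (r \<odot>\<^bsub>M\<^esub> x) = r \<odot>\<^bsub>M\<^esub> ?h x" if rx: "r \<in> carrier R" "x \<in> carrier M" for r x
  proof -
    obtain a where a: "a \<in> carrier M" "x = g a"
      using surj rx by blast
    then have "g (r \<odot>\<^bsub>M\<^esub> a) = r \<odot>\<^bsub>M\<^esub> x" using g rx by (simp add: carrier_module_aut_iff)
    then show ?thesis using hg[of "r \<odot>\<^bsub>M\<^esub> a"] hg[of a] a smult rx by metis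
  qed
  moreover have "bij_betw ?h (carrier M) (carrier M)"
    using bij_betw_inv_into[OF bij] by (subst bij_betw_restrict_eq)
  ultimately show "?h \<in> carrier (module_aut R M)"
    unfolding carrier_module_aut_iff by blast
qed

lemma stabilizer_orbit_subset:
  assumes "X \<in> orbits (stabilizer_group G e) E (\<lambda>g. g)"
    and "\<And>g z. g \<in> carrier G \<Longrightarrow> z \<in> E \<Longrightarrow> g z \<in> E"
  shows "X \<subseteq> E"
  using assms by (auto simp: orbits_def orbit_def stabilizer_group_def stabilizer_def)

text \<open>The orbit of \<open>(e, f)\<close> contains \<open>{e} \<times> X\<close> because the
  stabilizer moves \<open>f\<close> to every point of \<open>X\<close>. Any orbit containing
  \<open>{e} \<times> X\<close> contains \<open>(e, f)\<close> and so coincides with it, which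
  justifies the definite description.\<close>

lemma transitive_subset_eq:
  assumes add: "\<And>x y. x \<in> carrier M \<Longrightarrow> y \<in> carrier M \<Longrightarrow> x \<oplus>\<^bsub>M\<^esub> y \<in> carrier M"
    and smult: "\<And>r x. r \<in> carrier R \<Longrightarrow> x \<in> carrier M \<Longrightarrow> r \<odot>\<^bsub>M\<^esub> x \<in> carrier M"
    and G: "G = module_aut R M" and EM: "E \<subseteq> carrier M"
    and inv: "\<And>g z. g \<in> carrier G \<Longrightarrow> z \<in> E \<Longrightarrow> g z \<in> E"
    and X: "X \<in> orbits (stabilizer_group G e) E (\<lambda>g. g)"
    and e: "e \<in> E" and f: "f \<in> X"
  shows "transitive_subset G E e X = {(g e, g f) |g. g \<in> carrier G}"
proof -
  define T where "T = orbit G (\<lambda>g. map_prod g g) (e, f)"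
  have T: "T = {(g e, g f) |g. g \<in> carrier G}" by (auto simp: T_def orbit_def)
  have XE: "X \<subseteq> E" using X inv by (rule stabilizer_orbit_subset)
  then have fE: "f \<in> E" using f by blast
  have comp: "compose (carrier M) g h \<in> carrier G" "compose (carrier M) g h z = g (h z)"
    if "g \<in> carrier G" "h \<in> carrier G" "z \<in> E" for g h z
    using that module_aut_compose[of M R g h] add smult EM by (auto simp: G compose_eq)
  obtain z0 where z0: "z0 \<in> E" "X = {g z0 |g. g \<in> carrier G \<and> g e = e}"
    using X by (auto simp: orbits_def orbit_def stabilizer_group_def stabilizer_def)
  obtain g0 where g0: "g0 \<in> carrier G" "g0 e = e" "f = g0 z0"
    using f z0 by blast
  obtain h0 where h0: "h0 \<in> carrier G" "\<And>x. x \<in> carrier M \<Longrightarrow> h0 (g0 x) = x"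
    using module_aut_inverse[of M R g0] add smult g0 unfolding G by metis
  have "(e, z) \<in> T" if "z \<in> X" for z
  proof -
    obtain g where g: "g \<in> carrier G" "g e = e" "z = g z0" using z0 \<open>z \<in> X\<close> by blast
    \<comment> \<open>\<open>f\<close> need not be the base point \<open>z0\<close>: first
      \<open>h0\<close> returns it to \<open>z0\<close>, then \<open>g\<close> sends it to
      \<open>z\<close>.\<close>
    have "h0 e = e" "h0 f = z0" using h0(2) g0 e z0(1) EM by (metis subsetD)+
    then have "compose (carrier M) g h0 e = e" "compose (carrier M) g h0 f = z"
      using comp(2)[OF g(1) h0(1)] e fE g by auto
    then have "(e, z) = (compose (carrier M) g h0 e, compose (carrier M) g h0 f)" by simp
    then show ?thesis using comp(1)[OF g(1) h0(1) e] unfolding T by blast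
  qed
  then have sub: "{e} \<times> X \<subseteq> T" by auto
  have orb: "T \<in> orbits G (E \<times> E) (\<lambda>g. map_prod g g)"
    unfolding orbits_def T_def using e fE by blast
  have unique: "T' = T"
    if T': "T' \<in> orbits G (E \<times> E) (\<lambda>g. map_prod g g)" and sub': "{e} \<times> X \<subseteq> T'" for T'
  proof -
    obtain u v where uv: "u \<in> E" "v \<in> E" "T' = {(g u, g v) |g. g \<in> carrier G}"
      using T' by (auto simp: orbits_def orbit_def)
    moreover have "(e, f) \<in> T'" using sub' f by blast
    ultimately obtain g where g: "g \<in> carrier G" "e = g u" "f = g v" by blast
    obtain h where h: "h \<in> carrier G" "\<And>x. x \<in> carrier M \<Longrightarrow> h (g x) = x"
      using module_aut_inverse[of M R g] add smult g unfolding G by metis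
    \<comment> \<open>With \<open>g\<close> and its inverse \<open>h\<close>, the base points
      \<open>(u, v)\<close> and \<open>(e, f)\<close> can be exchanged.\<close>
    then have huv: "h e = u" "h f = v" using g(2,3) uv(1,2) EM by blast+
    show ?thesis
    proof
      show "T' \<subseteq> T"
      proof
        fix t assume "t \<in> T'"
        then obtain k where k: "k \<in> carrier G" "t = (k u, k v)" unfolding uv(3) by blast
        then have "t = (compose (carrier M) k h e, compose (carrier M) k h f)"
          using comp(2)[OF k(1) h(1) e] comp(2)[OF k(1) h(1) fE] huv by simp
        then show "t \<in> T" using comp(1)[OF k(1) h(1) e] unfolding T by blast
      qed
      show "T \<subseteq> T'"
      proof
        fix t assume "t \<in> T"
        then obtain k where k: "k \<in> carrier G" "t = (k e, k f)" unfolding T by blast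
        then have "t = (compose (carrier M) k g u, compose (carrier M) k g v)"
          using comp(2)[OF k(1) g(1) uv(1)] comp(2)[OF k(1) g(1) uv(2)] g(2,3) by simp
        then show "t \<in> T'" using comp(1)[OF k(1) g(1) e] uv(3) by blast
      qed
    qed
  qed
  have "transitive_subset G E e X = T"
    unfolding transitive_subset_def using orb sub unique by (metis (no_types, lifting) the_equality)
  then show ?thesis unfolding T .
qed

section \<open>Boundary valuations and the characteristic element\<close>

text \<open>Finiteness of \<open>Y\<close> excludes infinite ascending chains such as
  \<open>(0, 1)\<close>, \<open>(0, 2)\<close>, and so on. Among the generators above
  \<open>y\<close>, one of largest rank is maximal in the whole ideal.\<close>

lemma ideal_gen_below_max:
  assumes "finite Y" "Y \<subseteq> fund" "y \<in> ideal_gen Y"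
  shows "\<exists>x\<in>max_elems (ideal_gen Y). fund_le y x"
proof -
  \<comment> \<open>A strictly monotone rank function on the poset.\<close>
  define \<mu> where "\<mu> z = int (snd z) - 2 * int (fst z)" for z :: "nat \<times> nat"
  have mono: "\<mu> x \<le> \<mu> z \<and> (\<mu> x = \<mu> z \<longrightarrow> x = z)"
    if "fund_le x z" "x \<in> fund" "z \<in> fund" for x z
  proof -
    obtain v l v' l' where "x = (v, l)" "z = (v', l')" by (metis surj_pair)
    moreover from this have "v' \<le> v" "l - v \<le> l' - v'" "v < l" "v' < l'"
      using that by (simp_all add: fund_le_def fund_def)
    \<comment> \<open>Over the integers the rank is \<open>(l - v) - v\<close>. Going up,
      \<open>l - v\<close> does not decrease and \<open>v\<close> does not increase, so equal ranks
      force equal pairs.\<close>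
    then have "int v' \<le> int v" "int l - int v \<le> int l' - int v'" by linarith+
    ultimately show ?thesis by (simp add: \<mu>_def)
  qed
  define Z where "Z = {z \<in> Y. fund_le y z}"
  have finZ: "finite (\<mu> ` Z)" and "\<mu> ` Z \<noteq> {}"
    using assms(1,3) by (auto simp: ideal_gen_def Z_def)
  then have "Max (\<mu> ` Z) \<in> \<mu> ` Z" by (rule Max_in)
  then obtain x where x: "x \<in> Z" "\<mu> x = Max (\<mu> ` Z)" by force
  have xf: "x \<in> fund" "x \<in> Y" "fund_le y x" using x(1) assms(2) by (auto simp: Z_def)
  have xg: "x \<in> ideal_gen Y" using xf by (auto simp: ideal_gen_def fund_le_def)
  have "w = x" if w: "w \<in> ideal_gen Y" "fund_le x w" for w
  proof -
    obtain z where z: "z \<in> Y" "fund_le w z" "w \<in> fund"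
      using w(1) unfolding ideal_gen_def by blast
    have zf: "z \<in> fund" using z(1) assms(2) by blast
    have "fund_le y z" using fund_le_trans[OF fund_le_trans[OF xf(3) w(2)] z(2)] .
    then have "z \<in> Z" using z(1) by (simp add: Z_def)
    then have "\<mu> z \<le> \<mu> x" unfolding x(2) using finZ by (intro Max_ge imageI)
    \<comment> \<open>The ranks of \<open>x\<close>, \<open>w\<close> and \<open>z\<close> are
      squeezed to equality.\<close>
    then show ?thesis
      using mono[OF w(2) xf(1) z(3)] mono[OF z(2,3) zf] by (metis order_antisym order_trans)
  qed
  then have "x \<in> max_elems (ideal_gen Y)" using xg by (simp add: max_elems_def)
  then show ?thesis using xf(3) by blast
qed

text \<open>At a fixed exponent, raising the valuation moves down in the poset.\<close>

lemma order_ideal_upward_val: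
  "order_ideal D \<Longrightarrow> (v, l) \<in> D \<Longrightarrow> v \<le> w \<Longrightarrow> w < l \<Longrightarrow> (w, l) \<in> D"
  unfolding order_ideal_def by (erule conjE, drule bspec, assumption) (simp add: fund_def fund_le_def)

lemma boundary_val_le: "(v, l) \<in> D \<Longrightarrow> boundary_val D l \<le> enat v"
  unfolding boundary_val_def by (rule INF_lower) simp

text \<open>A finite infimum is attained, and the empty set would give \<infinity>.\<close>

lemma boundary_val_mem:
  assumes "boundary_val D l = enat v"
  shows "(v, l) \<in> D"
proof -
  have "{v. (v, l) \<in> D} \<noteq> {}"
  proof
    assume "{v. (v, l) \<in> D} = {}"
    then have "boundary_val D l = \<infinity>" unfolding boundary_val_def by (simp add: top_enat_def)
    then show False using assms by simp
  qed
  then have "boundary_val D l \<in> enat ` {v. (v, l) \<in> D}"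
    unfolding boundary_val_def by (intro enat_Inf_mem) simp
  then show ?thesis using assms by auto
qed

context uniformized_dvr
begin

text \<open>Either the unit is the exact quotient and the difference vanishes, or it is \<open>1\<close> and the
  difference has valuation \<open>n\<close>; in the first case the premise of the implication is false.\<close>

lemma unit_approximation:
  assumes r: "r \<in> carrier R" and div: "p [^] (n::nat) divides r"
  shows "\<exists>y\<in>Units R. \<forall>w. cyc_val R p l (res R p l (p [^] n \<otimes> y \<ominus> r)) = enat w \<longrightarrow>
    p [^] Suc n divides r \<and> n \<le> w"
proof (cases "p [^] Suc n divides r")
  case True
  have "n \<le> w" if "cyc_val R p l (res R p l (p [^] n \<otimes> \<one> \<ominus> r)) = enat w" for w
  proof (rule ccontr)
    assume "\<not> n \<le> w"
    moreover have "p [^] n divides (p [^] n \<otimes> \<one> \<ominus> r)"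
      using p_pow_divides_minus[of "p [^] n" r n] div r p_pow_divides_p_pow[of n n] by simp
    ultimately have "p [^] Suc w divides (p [^] n \<otimes> \<one> \<ominus> r)"
      using p_pow_divides_mono[of "p [^] n \<otimes> \<one> \<ominus> r" n "Suc w"] r by simp
    then show False using that cyc_val_eq_iff[of "p [^] n \<otimes> \<one> \<ominus> r" l w] r by simp
  qed
  then show ?thesis using True by (intro bexI[of _ \<one>]) auto
next
  case False
  obtain u where u: "u \<in> carrier R" "r = p [^] n \<otimes> u" using div by (auto simp: factor_def)
  have "\<not> p divides u"
  proof
    assume "p divides u"
    then have "p [^] Suc 0 divides u" unfolding p_pow_one .
    then have "p [^] Suc n divides r"
      using p_pow_divides_mult_iff[OF u(1), of "Suc 0" n] unfolding u(2) plus_1_eq_Suc[unfolded One_nat_def]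
      by metis
    then show False using False by metis
  qed
  then have "u \<in> Units R" using unit_iff_not_p_divides u by blast
  moreover have "p [^] n \<otimes> u \<ominus> r = \<zero>" using u by (simp add: minus_eq r_neg)
  moreover have "cyc_val R p l (res R p l \<zero>) = \<infinity>"
    using cyc_val_eq_infinity_iff[of \<zero> l] p_pow_divides_zero by simp
  ultimately show ?thesis by (intro bexI[of _ u]) auto
qed

lemma enat_pow_carrier [simp]: "enat_pow R p v \<in> carrier R"
  by (auto simp: enat_pow_def split: enat.split)

lemma p_pow_divides_enat_pow: "enat n \<le> v \<Longrightarrow> p [^] n divides enat_pow R p v"
  using p_pow_divides_p_pow p_pow_divides_zero by (auto simp: enat_pow_def split: enat.split)

lemma cyc_val_res_zero: "cyc_val R p l (res R p l \<zero>) = \<infinity>"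
  using cyc_val_eq_infinity_iff[of \<zero> l] p_pow_divides_zero by simp

text \<open>Let \<open>b\<close> and \<open>c\<close> be the boundary valuations of
  \<open>J \<union> K\<close> and \<open>K\<close>; \<open>c\<close> may be infinite. If
  \<open>b = c\<close>, the difference is zero and has no finite valuation. If \<open>b < c\<close>,
  then \<open>(b, l)\<close> is not in \<open>K\<close>, hence in \<open>J\<close>, and
  \<open>p [^] b\<close> divides the difference.\<close>

lemma cyc_val_boundary_diff:
  assumes J: "order_ideal J"
    and w: "cyc_val R p l (res R p l (enat_pow R p (boundary_val (J \<union> K) l)
              \<ominus> enat_pow R p (boundary_val K l))) = enat w"
  shows "(w, l) \<in> J"
proof -
  let ?d = "enat_pow R p (boundary_val (J \<union> K) l) \<ominus> enat_pow R p (boundary_val K l)"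
  have d: "?d \<in> carrier R" by simp
  have le: "boundary_val (J \<union> K) l \<le> boundary_val K l"
    unfolding boundary_val_def by (rule INF_superset_mono) auto
  have "boundary_val (J \<union> K) l \<noteq> boundary_val K l"
  proof
    assume "boundary_val (J \<union> K) l = boundary_val K l"
    then have "?d = \<zero>" by (simp add: minus_eq r_neg)
    then show False using w cyc_val_res_zero by (metis enat.distinct(1))
  qed
  with le have lt: "boundary_val (J \<union> K) l < boundary_val K l" by simp
  then obtain b where b: "boundary_val (J \<union> K) l = enat b"
    by (cases "boundary_val (J \<union> K) l") auto
  have "(b, l) \<notin> K" using lt boundary_val_le[of b l K] unfolding b by (metis leD)
  then have bJ: "(b, l) \<in> J" using boundary_val_mem[OF b] by blast
  have "p [^] b divides ?d"
    using p_pow_divides_minus[OF enat_pow_carrier enat_pow_carrier p_pow_divides_enat_pow p_pow_divides_enat_pow]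
      le[unfolded b] b by (metis order_refl)
  moreover have ww: "w < l" "\<not> p [^] Suc w divides ?d"
    using w unfolding cyc_val_eq_iff[OF d] by blast+
  ultimately have "b \<le> w" using p_pow_divides_mono[OF d, of b "Suc w"] not_less_eq_eq by metis
  then show ?thesis using order_ideal_upward_val[OF J bJ] ww by simp
qed

lemma res_carrier [simp]: "r \<in> carrier R \<Longrightarrow> res R p l r \<in> carrier (cyc R p l)"
  by (simp add: carrier_cyc)

text \<open>The element splits as \<open>c\<close> plus \<open>j\<close>, where \<open>c\<close> is
  the characteristic element of \<open>K\<close> alone. The hypothesis \<open>first\<close> provides
  the distinguished position in every block that meets \<open>A\<close>; the element
  \<open>n\<close> shows that \<open>K\<close> is generated at exponents occurring in
  \<open>A\<close>.\<close>

lemma char_elem_decomposition: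
  fixes A :: "(nat \<times> nat) set" and lam :: "nat \<Rightarrow> nat"
  defines "N \<equiv> type_module R p lam A"
  assumes fin: "finite A" and pos: "\<forall>(i, j)\<in>A. 0 < lam i"
    and first: "\<forall>(i, j)\<in>A. (i, if i \<in> S then 2 else 1) \<in> A"
    and n: "n \<in> carrier N" and K: "K = elem_ideal R p N n" and J: "order_ideal J"
  shows "char_elem R p lam A S (J \<union> K) \<in> at_ideal R p N K <+>\<^bsub>N\<^esub> below_ideal R p N J"
proof -
  define \<nu> where "\<nu> = (\<lambda>(i, j::nat). lam i)"
  have N: "N = cyc_sum R p A \<nu>" by (simp add: N_def type_module_def \<nu>_def)
  have pos': "\<forall>a\<in>A. 0 < \<nu> a" using pos by (auto simp: \<nu>_def)
  let ?f = "\<lambda>i. if i \<in> S then 2 else 1 :: nat"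
  \<comment> \<open>The correction from \<open>K\<close> to \<open>J \<union> K\<close>, supported
    at the distinguished positions.\<close>
  define j where "j = (\<lambda>(i, j)\<in>A. res R p (lam i) (if j = ?f i then
     enat_pow R p (boundary_val (J \<union> K) (lam i)) \<ominus> enat_pow R p (boundary_val K (lam i)) else \<zero>))"
  define c where "c = char_elem R p lam A S K"
  have jc: "j \<in> carrier N" by (auto simp: N cyc_sum_def j_def \<nu>_def)
  have cc: "c \<in> carrier N" by (auto simp: N cyc_sum_def c_def char_elem_def \<nu>_def)
  have "elem_ideal R p N j \<subseteq> J"
    unfolding N
  proof (subst elem_ideal_cyc_sum_subset_iff[OF fin pos' _ J])
    show "j \<in> carrier (cyc_sum R p A \<nu>)" using jc N by simp
    show "\<forall>a\<in>A. \<forall>w. cyc_val R p (\<nu> a) (j a) = enat w \<longrightarrow> (w, \<nu> a) \<in> J"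
    proof (intro ballI allI impI)
      fix a w assume a: "a \<in> A" and w: "cyc_val R p (\<nu> a) (j a) = enat w"
      obtain i b where ib: "a = (i, b)" by (cases a)
      have "b = ?f i"
      proof (rule ccontr)
        assume "b \<noteq> ?f i"
        then have "j a = res R p (\<nu> a) \<zero>" using a ib by (simp add: j_def \<nu>_def)
        then show False using w cyc_val_res_zero by (metis enat.distinct(1))
      qed
      then have "j a = res R p (\<nu> a) (enat_pow R p (boundary_val (J \<union> K) (\<nu> a))
          \<ominus> enat_pow R p (boundary_val K (\<nu> a)))"
        using a ib by (simp add: j_def \<nu>_def)
      then show "(w, \<nu> a) \<in> J" using w cyc_val_boundary_diff[OF J] by metis
    qed
  qed
  then have jb: "j \<in> below_ideal R p N J" using jc by (simp add: below_ideal_def)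
  have Kid: "order_ideal K" by (simp add: K order_ideal_elem_ideal)
  have "elem_ideal R p N c = K"
    unfolding N
  proof (subst elem_ideal_cyc_sum[OF fin pos'])
    show "c \<in> carrier (cyc_sum R p A \<nu>)" using cc N by simp
    show "ideal_gen {(w, \<nu> a) |w a. a \<in> A \<and> cyc_val R p (\<nu> a) (c a) = enat w} = K"
    proof (rule ideal_gen_eqI[OF Kid])
      show "{(w, \<nu> a) |w a. a \<in> A \<and> cyc_val R p (\<nu> a) (c a) = enat w} \<subseteq> K"
        by (auto simp: \<nu>_def c_def char_elem_def cyc_val_p_pow cyc_val_res_zero
            split: if_splits intro: boundary_val_mem)
    next
      fix y assume y: "y \<in> K"
      then have "y \<in> ideal_gen {(w, \<nu> a) |w a. a \<in> A \<and> cyc_val R p (\<nu> a) (n a) = enat w}"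
        using elem_ideal_cyc_sum[OF fin pos'] n K N by simp
      then obtain w i j where wij: "(i, j) \<in> A" "cyc_val R p (lam i) (n (i, j)) = enat w"
        "fund_le y (w, lam i)"
        by (auto simp: ideal_gen_def \<nu>_def)
      have "(w, lam i) \<in> K"
        using elem_ideal_cyc_sum_subset_iff[OF fin pos' _ Kid, of n] n K N wij(1,2)
        by (force simp: \<nu>_def)
      \<comment> \<open>The generator coming from \<open>n\<close> is replaced by the one at the
        boundary valuation, which lies above it and is attained by \<open>c\<close>.\<close>
      then obtain b where b: "boundary_val K (lam i) = enat b" "b \<le> w"
        using boundary_val_le by (metis enat_ile enat_ord_simps(1))
      have "b < lam i"
        using boundary_val_mem[OF b(1)] Kid by (auto simp: order_ideal_def fund_def)
      moreover have fi: "(i, ?f i) \<in> A" using first wij(1) by auto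
      ultimately have "cyc_val R p (lam i) (c (i, ?f i)) = enat b"
        using b by (simp add: c_def char_elem_def cyc_val_p_pow)
      then have "(b, lam i) \<in> {(w, \<nu> a) |w a. a \<in> A \<and> cyc_val R p (\<nu> a) (c a) = enat w}"
        using fi by (force simp: \<nu>_def)
      moreover have "fund_le y (b, lam i)" using wij(3) b by (auto simp: fund_le_def)
      ultimately show "\<exists>x\<in>{(w, \<nu> a) |w a. a \<in> A \<and> cyc_val R p (\<nu> a) (c a) = enat w}. fund_le y x"
        by blast
    qed
  qed
  then have ca: "c \<in> at_ideal R p N K" using cc by (simp add: at_ideal_def)
  have cancel: "b \<oplus> (a \<ominus> b) = a" if "a \<in> carrier R" "b \<in> carrier R" for a b
    using that by algebra
  have "char_elem R p lam A S (J \<union> K) = c \<oplus>\<^bsub>N\<^esub> j"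
  proof
    fix a :: "nat \<times> nat"
    obtain i b where ib: "a = (i, b)" by (cases a)
    show "char_elem R p lam A S (J \<union> K) a = (c \<oplus>\<^bsub>N\<^esub> j) a"
      by (cases "a \<in> A"; cases "b = ?f i")
        (simp_all add: ib N cyc_sum_def c_def char_elem_def j_def \<nu>_def res_add cancel)
  qed
  then show ?thesis using ca jb unfolding set_add_def' by blast
qed

lemma cyc_sum_coordinate:
  "z \<in> carrier (cyc_sum R p A \<nu>) \<Longrightarrow> a \<in> A \<Longrightarrow> z a \<in> carrier (cyc R p (\<nu> a))"
  by (auto simp: cyc_sum_def)

lemma add_cyc_sum_closed:
  assumes "y \<in> carrier (cyc_sum R p A \<nu>)" "z \<in> carrier (cyc_sum R p A \<nu>)"
  shows "y \<oplus>\<^bsub>cyc_sum R p A \<nu>\<^esub> z \<in> carrier (cyc_sum R p A \<nu>)"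
proof -
  have "y a \<oplus>\<^bsub>cyc R p (\<nu> a)\<^esub> z a \<in> carrier (cyc R p (\<nu> a))" if "a \<in> A" for a
    by (rule cring.cring_simprules(1)[OF cring_cyc cyc_sum_coordinate[OF assms(1) that]
          cyc_sum_coordinate[OF assms(2) that]])
  then have "(\<lambda>a\<in>A. y a \<oplus>\<^bsub>cyc R p (\<nu> a)\<^esub> z a) \<in> (\<Pi>\<^sub>E a\<in>A. carrier (cyc R p (\<nu> a)))"
    by (intro restrict_PiE_iff[THEN iffD2] ballI)
  then show ?thesis by (simp add: cyc_sum_def)
qed

end

section \<open>The transitive subset of an orbit\<close>

theorem theorem15:
  fixes R :: "('a, 'b) ring_scheme" and p :: 'a
    and k :: nat and lam rho s :: "nat \<Rightarrow> nat"
    and I J K :: "(nat \<times> nat) set" and S :: "nat set"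
    and A A' A'' :: "(nat \<times> nat) set"
    and M M' M'' :: "('a, nat \<times> nat \<Rightarrow> 'a set) module"
    and m m' m'' e e' x :: "nat \<times> nat \<Rightarrow> 'a set"
    and G :: "((nat \<times> nat \<Rightarrow> 'a set) \<Rightarrow> (nat \<times> nat \<Rightarrow> 'a set)) monoid"
    and E X :: "(nat \<times> nat \<Rightarrow> 'a set) set"
  assumes "discrete_valuation_ring R" and "uniformizer R p"
    and "finite (carrier (R Quot (PIdl\<^bsub>R\<^esub> p)))"
    and "strict_antimono_on {1..k} lam" and "\<forall>i\<in>{1..k}. 1 \<le> lam i \<and> 1 \<le> rho i"
    and "I \<in> type_ideals (lam ` {1..k})"
    and "S \<subseteq> {1..k}" and "S \<noteq> {}" and "max_elems I = (\<lambda>i. (s i, lam i)) ` S"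
    and "A = type_index k rho" and "A' = first_index S" and "A'' = rest_index k rho S"
    and "M = type_module R p lam A"
    and "M' = type_module R p lam A'" and "M'' = type_module R p lam A''"
    and "G = module_aut R M"
    and "E = at_ideal R p M I"
    and "e = canonical_form R p lam A S s" and "e' = restrict e A'"
    and "m \<in> E" and "m' = restrict m A'" and "m'' = restrict m A''"
    and "J = elem_ideal R p (quot_module M' (cyc_submodule R M' e'))
               (cyc_submodule R M' e' +>\<^bsub>M'\<^esub> m')"
    and "K = elem_ideal R p M'' m''"
    and "X = orbit_set R p lam A' A'' m' J K"
    and "X \<in> orbits (stabilizer_group G e) E (\<lambda>g. g)"
    and "x = char_elem R p lam A'' S (type_part ((\<lambda>(i, j). lam i) ` A'') (J \<union> K))"
  shows "\<exists>y. (\<forall>i\<in>S. y i \<in> Units R) \<and>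
           (let f = (\<lambda>(i, j)\<in>A. if (i, j) \<in> A'
                                then res R p (lam i) (p [^]\<^bsub>R\<^esub> s i \<otimes>\<^bsub>R\<^esub> y i)
                                else x (i, j))
            in f \<in> X \<and> X \<subseteq> E \<and>
               transitive_subset G E e X = {(g e, g f) | g. g \<in> carrier G})"
proof -

  \<comment> \<open>Index sets, summands and the ideal of \<open>m\<close>\<close>
  interpret uniformized_dvr R p
    using assms(1,2) by (simp add: uniformized_dvr_def uniformized_dvr_axioms_def)
  define \<nu> where "\<nu> = (\<lambda>(i, j::nat). lam i)"
  have type_mod: "type_module R p lam B = cyc_sum R p B \<nu>" for B
    by (simp add: type_module_def \<nu>_def)
  have A: "(i, j) \<in> A \<longleftrightarrow> i \<in> {1..k} \<and> 1 \<le> j \<and> j \<le> rho i" for i j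
    by (auto simp: \<open>A = type_index k rho\<close> type_index_def)
  have A': "(i, j) \<in> A' \<longleftrightarrow> i \<in> S \<and> j = 1" for i j
    by (auto simp: \<open>A' = first_index S\<close> first_index_def)
  have A'A: "A' \<subseteq> A" using A A' \<open>S \<subseteq> {1..k}\<close> assms(5) by auto
  have A'': "A'' = A - A'"
    by (simp add: \<open>A'' = rest_index k rho S\<close> rest_index_def \<open>A = type_index k rho\<close> \<open>A' = first_index S\<close>)
  have fin: "finite A" by (simp add: \<open>A = type_index k rho\<close> type_index_def)
  have fin': "finite A'" and fin'': "finite A''"
    using fin A'A A'' by (auto intro: finite_subset)
  have pos: "\<forall>a\<in>A. 0 < \<nu> a"
  proof
    fix a assume "a \<in> A"
    moreover obtain i j where "a = (i, j)" by (cases a)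
    ultimately have "i \<in> {1..k}" "\<nu> a = lam i" using A by (auto simp: \<nu>_def)
    then show "0 < \<nu> a" using assms(5) by fastforce
  qed
  have pos': "\<forall>a\<in>A'. 0 < \<nu> a" and pos'': "\<forall>a\<in>A''. 0 < \<nu> a"
    using pos A'A A'' by auto
  have M: "M = cyc_sum R p A \<nu>" and M': "M' = cyc_sum R p A' \<nu>" and M'': "M'' = cyc_sum R p A'' \<nu>"
    by (simp_all add: assms(13-15) type_mod)
  have J: "order_ideal J" and K: "order_ideal K"
    by (simp_all add: assms(23,24) order_ideal_elem_ideal)
  have m: "m \<in> carrier M" and Im: "elem_ideal R p M m = I"
    using \<open>m \<in> E\<close> by (simp_all add: \<open>E = at_ideal R p M I\<close> at_ideal_def)
  define Y where "Y = {(w, \<nu> a) |w a. a \<in> A \<and> cyc_val R p (\<nu> a) (m a) = enat w}"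
  have IY: "I = ideal_gen Y"
    using elem_ideal_cyc_sum[OF fin pos] m Im by (simp add: M Y_def)
  have I: "order_ideal I" unfolding IY by (rule order_ideal_ideal_gen)
  have finY: "finite Y"
  proof (rule finite_subset)
    \<comment> \<open>An index contributes at most one pair, and none if its valuation is
      infinite.\<close>
    show "Y \<subseteq> (\<lambda>a. (the_enat (cyc_val R p (\<nu> a) (m a)), \<nu> a)) ` A" by (force simp: Y_def)
  qed (simp add: fin)
  have mI: "(w, \<nu> a) \<in> I" if "a \<in> A" "cyc_val R p (\<nu> a) (m a) = enat w" for a w
    using elem_ideal_cyc_sum_subset_iff[OF fin pos _ I] m Im that by (auto simp: M)
  have YI: "Y \<subseteq> I" using mI by (auto simp: Y_def)
  have Yf: "Y \<subseteq> fund" using YI I by (auto simp: order_ideal_def)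
  have max: "(s i, lam i) \<in> I" "\<And>y. y \<in> I \<Longrightarrow> fund_le (s i, lam i) y \<Longrightarrow> y = (s i, lam i)"
    if "i \<in> S" for i
    using that assms(9) by (auto simp: max_elems_def)
  have slt: "s i < lam i" if "i \<in> S" for i
    using max(1)[OF that] I by (auto simp: order_ideal_def fund_def)
  have lam_inj: "i = j" if "i \<in> {1..k}" "j \<in> {1..k}" "lam i = lam j" for i j
    using assms(4) that unfolding monotone_on_def by (metis linorder_neq_iff order_less_irrefl)

  \<comment> \<open>The ideal of the canonical form\<close>
  have "e \<in> carrier M"
    by (auto simp: M \<open>e = canonical_form R p lam A S s\<close> canonical_form_def cyc_sum_def \<nu>_def)
  moreover have "elem_ideal R p M e = I"
  proof -
    \<comment> \<open>As \<open>s i < lam i\<close>, the entry at \<open>(i, 1)\<close> is non-zero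
      for \<open>i\<close> in \<open>S\<close>.\<close>
    have val: "cyc_val R p (lam i) (e (i, j)) = enat w \<longleftrightarrow> i \<in> S \<and> j = 1 \<and> w = s i"
      if "(i, j) \<in> A" for i j w
      using that slt cyc_val_p_pow[of "lam i" "enat (s i)"]
      by (auto simp: assms(18) canonical_form_def cyc_val_res_zero enat_pow_def)
    have "{(w, \<nu> a) |w a. a \<in> A \<and> cyc_val R p (\<nu> a) (e a) = enat w} = max_elems I"
      (is "?Z = _")
    proof
      show "?Z \<subseteq> max_elems I"
      proof
        fix z assume "z \<in> ?Z"
        then obtain w i j where "z = (w, lam i)" "(i, j) \<in> A"
          "cyc_val R p (lam i) (e (i, j)) = enat w"
          by (auto simp: \<nu>_def)
        then show "z \<in> max_elems I" using val unfolding assms(9) by blast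
      qed
      show "max_elems I \<subseteq> ?Z"
      proof
        fix z assume "z \<in> max_elems I"
        then obtain i where i: "i \<in> S" "z = (s i, lam i)" unfolding assms(9) by blast
        then have "(i, 1) \<in> A" using A'A A' by blast
        then have "cyc_val R p (\<nu> (i, 1)) (e (i, 1)) = enat (s i)" "z = (s i, \<nu> (i, 1))"
          using val[of i 1 "s i"] i by (simp_all add: \<nu>_def)
        then show "z \<in> ?Z" using \<open>(i, 1) \<in> A\<close> by blast
      qed
    qed
    moreover have "ideal_gen (max_elems I) = I"
    proof (rule ideal_gen_eqI[OF I])
      show "max_elems I \<subseteq> I" by (auto simp: max_elems_def)
      \<comment> \<open>The finite generating set \<open>Y\<close> ensures that each element of
        \<open>I\<close> lies below a maximal one.\<close>
      show "\<exists>x\<in>max_elems I. fund_le y x" if "y \<in> I" for y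
        using ideal_gen_below_max[OF finY Yf] that unfolding IY by blast
    qed
    ultimately show ?thesis
      using elem_ideal_cyc_sum[OF fin pos] \<open>e \<in> carrier M\<close> by (simp add: M)
  qed
  ultimately have eE: "e \<in> E" by (simp add: \<open>E = at_ideal R p M I\<close> at_ideal_def)

  \<comment> \<open>Units approximating the first coordinates of \<open>m\<close>\<close>
  have "\<exists>r\<in>carrier R. m (i, 1) = res R p (lam i) r" if "i \<in> S" for i
  proof -
    have "(i, 1) \<in> A" using A'A A' that by blast
    then have "m (i, 1) \<in> carrier (cyc R p (lam i))"
      using cyc_sum_coordinate m unfolding M by (fastforce simp: \<nu>_def)
    then show ?thesis by (auto simp: carrier_cyc)
  qed
  then obtain r where r: "\<And>i. i \<in> S \<Longrightarrow> r i \<in> carrier R"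
    "\<And>i. i \<in> S \<Longrightarrow> m (i, 1) = res R p (lam i) (r i)"
    by metis
  have div: "p [^]\<^bsub>R\<^esub> s i divides\<^bsub>R\<^esub> r i" if i: "i \<in> S" for i
  proof (cases "cyc_val R p (lam i) (m (i, 1))")
    case (enat w)
    then have wI: "(w, lam i) \<in> I" using mI[of "(i, 1)" w] A'A A' i by (auto simp: \<nu>_def)
    \<comment> \<open>A smaller valuation would give an element of \<open>I\<close> strictly above
      the maximal one.\<close>
    have "s i \<le> w"
    proof (rule ccontr)
      assume "\<not> s i \<le> w"
      then have "fund_le (s i, lam i) (w, lam i)" by (auto simp: fund_le_def)
      then show False using max(2)[OF i wI] \<open>\<not> s i \<le> w\<close> by simp
    qed
    moreover have "p [^]\<^bsub>R\<^esub> w divides\<^bsub>R\<^esub> r i"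
      using enat r[OF i] cyc_val_eq_iff by metis
    ultimately show ?thesis using p_pow_divides_mono r(1)[OF i] by blast
  next
    case infinity
    then have "p [^]\<^bsub>R\<^esub> lam i divides\<^bsub>R\<^esub> r i"
      using r[OF i] cyc_val_eq_infinity_iff by metis
    then show ?thesis using p_pow_divides_mono[OF r(1)[OF i]] slt[OF i] by (metis less_imp_le)
  qed
  \<comment> \<open>A difference that survives modulo the power \<open>lam i\<close> of
    \<open>p\<close> has valuation at least \<open>s i\<close>, and it forces the first coordinate
    to miss the valuation \<open>s i\<close>.\<close>
  have "\<forall>i\<in>S. \<exists>u. u \<in> Units R \<and> (\<forall>w.
      cyc_val R p (lam i) (res R p (lam i) (p [^]\<^bsub>R\<^esub> s i \<otimes>\<^bsub>R\<^esub> u \<ominus>\<^bsub>R\<^esub> r i)) = enat w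
        \<longrightarrow> p [^]\<^bsub>R\<^esub> Suc (s i) divides\<^bsub>R\<^esub> r i \<and> s i \<le> w)"
    using unit_approximation[OF r(1) div] unfolding Bex_def by (rule ballI)
  from bchoice[OF this] obtain y where y: "\<And>i. i \<in> S \<Longrightarrow> y i \<in> Units R"
    "\<And>i w. i \<in> S \<Longrightarrow> cyc_val R p (lam i) (res R p (lam i) (p [^]\<^bsub>R\<^esub> s i \<otimes>\<^bsub>R\<^esub> y i \<ominus>\<^bsub>R\<^esub> r i)) = enat w
       \<Longrightarrow> p [^]\<^bsub>R\<^esub> Suc (s i) divides\<^bsub>R\<^esub> r i \<and> s i \<le> w"
    by blast
  have yc: "y i \<in> carrier R" if "i \<in> S" for i using y(1)[OF that] by auto
  have m''c: "m'' \<in> carrier M''"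
    using m by (auto simp: \<open>m'' = restrict m A''\<close> M M'' A'' cyc_sum_def)
  \<comment> \<open>Some coordinate of \<open>m\<close> attains the maximal element; if the first
    one of the block does not, a coordinate of \<open>m''\<close> does.\<close>
  have sK: "(s i, lam i) \<in> K" if i: "i \<in> S" and Suc: "p [^]\<^bsub>R\<^esub> Suc (s i) divides\<^bsub>R\<^esub> r i" for i
  proof -
    obtain z where "z \<in> Y" "fund_le (s i, lam i) z"
      using max(1)[OF i] unfolding IY ideal_gen_def by blast
    \<comment> \<open>A maximal element below a generator is that generator.\<close>
    then have "(s i, lam i) \<in> Y" using max(2)[OF i] YI by blast
    then obtain i' j where ij: "(i', j) \<in> A" "lam i' = lam i"
      "cyc_val R p (lam i') (m (i', j)) = enat (s i)"
      by (auto simp: Y_def \<nu>_def)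
    \<comment> \<open>Distinct blocks have distinct exponents.\<close>
    have "i' = i" using lam_inj ij(1,2) i \<open>S \<subseteq> {1..k}\<close> A by blast
    moreover have "j \<noteq> 1"
    proof
      assume "j = 1"
      then have "cyc_val R p (lam i) (res R p (lam i) (r i)) = enat (s i)"
        using ij(3) r(2)[OF i] \<open>i' = i\<close> by simp
      then show False using Suc cyc_val_eq_iff[OF r(1)[OF i]] by blast
    qed
    ultimately have "(i, j) \<in> A''" "cyc_val R p (lam i) (m'' (i, j)) = enat (s i)"
      using ij A'' A' \<open>m'' = restrict m A''\<close> by auto
    moreover have "elem_ideal R p (cyc_sum R p A'' \<nu>) m'' \<subseteq> K"
      using \<open>K = elem_ideal R p M'' m''\<close> M'' by simp
    then have "\<forall>a\<in>A''. \<forall>w. cyc_val R p (\<nu> a) (m'' a) = enat w \<longrightarrow> (w, \<nu> a) \<in> K"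
      using elem_ideal_cyc_sum_subset_iff[OF fin'' pos'' _ K] m''c unfolding M'' by blast
    ultimately show ?thesis by (fastforce simp: \<nu>_def)
  qed

  \<comment> \<open>The representative \<open>f\<close> and its two projections\<close>
  define f where "f = (\<lambda>(i, j)\<in>A. if (i, j) \<in> A'
     then res R p (lam i) (p [^]\<^bsub>R\<^esub> s i \<otimes>\<^bsub>R\<^esub> y i) else x (i, j))"
  have x: "x = char_elem R p lam A'' S (J \<union> K)"
  proof -
    \<comment> \<open>The exponents in question occur in \<open>A''\<close>, so passing to the type
      part leaves their boundary valuations unchanged.\<close>
    have "boundary_val (type_part (\<nu> ` A'') (J \<union> K)) (lam i) = boundary_val (J \<union> K) (lam i)"
      if "(i, j) \<in> A''" for i j
      using that J K by (intro boundary_val_type_part order_ideal_Un) (force simp: \<nu>_def)+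
    then show ?thesis
      unfolding assms(27) \<nu>_def[symmetric] char_elem_def by (intro restrict_ext) auto
  qed
  have xX: "x \<in> at_ideal R p M'' K <+>\<^bsub>M''\<^esub> below_ideal R p M'' J"
    unfolding x assms(15)
  proof (rule char_elem_decomposition[OF fin'' _ _ _ _ J])
    show "\<forall>(i, j)\<in>A''. 0 < lam i" using pos'' by (auto simp: \<nu>_def)
    \<comment> \<open>For \<open>i\<close> in \<open>S\<close> the index \<open>(i, 1)\<close>
      belongs to \<open>A'\<close>; an index of \<open>A''\<close> in that block has second entry at
      least 2, so \<open>(i, 2)\<close> exists.\<close>
    show "\<forall>(i, j)\<in>A''. (i, if i \<in> S then 2 else 1) \<in> A''"
      using A A' by (auto simp: A'')
  qed (use m''c assms(15,24) in simp_all)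
  have xc: "x \<in> carrier M''"
    by (auto simp: x M'' cyc_sum_def char_elem_def \<nu>_def)
  have fc: "f \<in> carrier M"
  proof -
    have "f a \<in> carrier (cyc R p (\<nu> a))" if a: "a \<in> A" for a
    proof -
      obtain i j where ij: "a = (i, j)" by (cases a)
      show ?thesis
      proof (cases "a \<in> A'")
        case True
        then show ?thesis using a ij yc A' by (simp add: f_def \<nu>_def)
      next
        case False
        then have "a \<in> A''" using a A'' by simp
        then have "x a \<in> carrier (cyc R p (\<nu> a))"
          using cyc_sum_coordinate[OF xc[unfolded M'']] by simp
        then show ?thesis using a ij False by (simp add: f_def)
      qed
    qed
    moreover have "f a = undefined" if "a \<notin> A" for a
      using that by (simp add: f_def)
    ultimately have "f \<in> (\<Pi>\<^sub>E a\<in>A. carrier (cyc R p (\<nu> a)))" by (intro PiE_I)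
    then show ?thesis by (simp add: M cyc_sum_def)
  qed
  have f'': "restrict f A'' = x"
  proof
    fix a :: "nat \<times> nat"
    obtain i j where "a = (i, j)" by (cases a)
    \<comment> \<open>Off \<open>A''\<close> both sides take the default value of extensional
      functions.\<close>
    moreover have "x a = undefined" if "a \<notin> A''"
      using xc that PiE_arb[of x A'' _ a] by (simp add: M'' cyc_sum_def)
    ultimately show "restrict f A'' a = x a"
      by (cases "a \<in> A''") (simp_all add: f_def A'')
  qed
  \<comment> \<open>The difference between the projection of \<open>f\<close> to \<open>A'\<close>
    and \<open>m'\<close>.\<close>
  define h where "h = (\<lambda>(i, j)\<in>A'. res R p (lam i) (p [^]\<^bsub>R\<^esub> s i \<otimes>\<^bsub>R\<^esub> y i \<ominus>\<^bsub>R\<^esub> r i))"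
  have hc: "h \<in> carrier M'"
    using yc r(1) A' by (auto simp: h_def M' cyc_sum_def \<nu>_def)
  have JK: "order_ideal (J \<union> K)" using J K by (rule order_ideal_Un)
  have "elem_ideal R p M' h \<subseteq> J \<union> K"
    unfolding M'
  proof (subst elem_ideal_cyc_sum_subset_iff[OF fin' pos' _ JK])
    show "h \<in> carrier (cyc_sum R p A' \<nu>)" using hc M' by simp
    show "\<forall>a\<in>A'. \<forall>w. cyc_val R p (\<nu> a) (h a) = enat w \<longrightarrow> (w, \<nu> a) \<in> J \<union> K"
    proof (intro ballI allI impI)
      fix a w assume a: "a \<in> A'" and w: "cyc_val R p (\<nu> a) (h a) = enat w"
      obtain i where i: "a = (i, 1)" "i \<in> S" using a A' by (cases a) auto
      have hw: "cyc_val R p (lam i) (res R p (lam i) (p [^]\<^bsub>R\<^esub> s i \<otimes>\<^bsub>R\<^esub> y i \<ominus>\<^bsub>R\<^esub> r i)) = enat w"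
        using w a i by (simp add: h_def \<nu>_def)
      have "w < \<nu> a" using cyc_val_enat_less[OF cyc_sum_coordinate[OF hc[unfolded M'] a] w] .
      then have "w < lam i" by (simp add: i \<nu>_def)
      \<comment> \<open>A finite valuation \<open>w\<close> of the difference puts
        \<open>(s i, lam i)\<close> in \<open>K\<close>, and raising the valuation from
        \<open>s i\<close> to \<open>w\<close> stays in \<open>K\<close>.\<close>
      moreover have "(s i, lam i) \<in> K" "s i \<le> w" using y(2)[OF i(2) hw] sK[OF i(2)] by auto
      ultimately have "(w, lam i) \<in> K" using order_ideal_upward_val[OF K] by blast
      then show "(w, \<nu> a) \<in> J \<union> K" using i by (simp add: \<nu>_def)
    qed
  qed
  then have hb: "h \<in> below_ideal R p M' (J \<union> K)" using hc by (simp add: below_ideal_def)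
  have cancel: "b \<oplus>\<^bsub>R\<^esub> (a \<ominus>\<^bsub>R\<^esub> b) = a" if "a \<in> carrier R" "b \<in> carrier R" for a b
    using that by algebra
  have "restrict f A' = m' \<oplus>\<^bsub>M'\<^esub> h"
  proof
    fix a
    show "restrict f A' a = (m' \<oplus>\<^bsub>M'\<^esub> h) a"
    proof (cases "a \<in> A'")
      case True
      then obtain i where i: "a = (i, 1)" "i \<in> S" using A' by (cases a) auto
      then show ?thesis
        using True A'A r[OF i(2)] yc[OF i(2)]
        by (auto simp: f_def h_def M' cyc_sum_def \<nu>_def \<open>m' = restrict m A'\<close> res_add cancel)
    qed (simp add: M' cyc_sum_def)
  qed
  then have f': "restrict f A' \<in> m' <+\<^bsub>M'\<^esub> below_ideal R p M' (J \<union> K)"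
    using hb unfolding a_l_coset_def' by blast
  have "A' \<union> A'' = A" using A'A A'' by blast
  then have fX: "f \<in> X"
    using fc f' f'' xX by (simp add: \<open>X = orbit_set R p lam A' A'' m' J K\<close> orbit_set_def Let_def
        assms(13-15))

  \<comment> \<open>Stability of \<open>E\<close> and the transitive subset\<close>
  have EM: "E \<subseteq> carrier M" by (auto simp: \<open>E = at_ideal R p M I\<close> at_ideal_def)
  have inv: "g z \<in> E" if "g \<in> carrier G" "z \<in> E" for g z
    using elem_ideal_automorphism[OF fin pos M, of g z] that
    by (simp add: assms(16,17) at_ideal_def)
  have "X \<subseteq> E" using assms(26) inv by (rule stabilizer_orbit_subset)
  moreover have "transitive_subset G E e X = {(g e, g f) |g. g \<in> carrier G}"
  proof (rule transitive_subset_eq[where M = M and R = R])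
    show "u \<oplus>\<^bsub>M\<^esub> v \<in> carrier M" if "u \<in> carrier M" "v \<in> carrier M" for u v
      using that unfolding M by (rule add_cyc_sum_closed)
    show "c \<odot>\<^bsub>M\<^esub> u \<in> carrier M" if "c \<in> carrier R" "u \<in> carrier M" for c u
      using that unfolding M by (rule smult_cyc_sum_closed)
    show "G = module_aut R M" "E \<subseteq> carrier M" "X \<in> orbits (stabilizer_group G e) E (\<lambda>g. g)"
      "e \<in> E" "f \<in> X"
      by (fact assms(16) EM assms(26) eE fX)+
    show "g z \<in> E" if "g \<in> carrier G" "z \<in> E" for g z using that by (rule inv)
  qed
  ultimately show ?thesis
    using y(1) fX unfolding f_def Let_def by blast
qed

end
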